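(* For every $S\in\mathcal B_T(H)$, $$\|S^*\|_{T,\mathrm{op}}=\|S\|_{T,\mathrm{op}}.$$
   Context: Setting. All spaces are real. $E$ is a Dedekind complete Riesz space with weak order unit $e$. $T:E\to E$ is a conditional expectation operator, i.e. a positive order-continuous linear projection whose range is a Dedekind complete Riesz subspace and which maps weak order units to weak order units; it satisfies $Te=e$ and is strictly positive ($x\ge 0$ and $Tx=0$ imply $x=0$). $E^u$ is the universal completion of $E$, with its $f$-algebra multiplication having unit $e$. $L^1(T)\subseteq E^u$ is the natural domain of $T$: the set of differences $f_1-f_2$ with $f_i\in E^u_+$ such that there is a net $(f_\alpha)$ in $E_+$ with $f_\alpha\uparrow f_i$ in $E^u$ and $(Tf_\alpha)$ bounded above in $E^u$; $T$ is extended to $L^1(T)$ by $Tf_i=\sup_\alpha Tf_\alpha$, and the extension, still denoted $T$, is again a strictly positive conditional expectation on $L^1(T)$ with $Te=e$. $A:=R(T)$ is the range of the (extended) $T$; it is a Dedekind complete unital Archimedean $f$-algebra with unit $e$, and $T(az)=aT(z)$ for $a\in A$ whenever the products are defined. $H:=L^2(T)=\{x\in L^1(T):x^2\in L^1(T)\}$ with the inherited order is a Dedekind complete Riesz space and an $A$-module. For $x,y\in H$, $\langle x,y\rangle_T:=T(xy)\in A$ and $\|x\|_{T,2}:=(T(x^2))^{1/2}\in A_+$ (the positive square root in $A$). Definitions. $\mathcal B_T(H)$ is the set of $A$-linear (additive and $A$-homogeneous) maps $S:H\to H$ that are $T$-strongly bounded: there is $k\in A_+$ with $\|Sx\|_{T,2}\le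 k\|x\|_{T,2}$ for all $x\in H$. For $S\in\mathcal B_T(H)$, the adjoint $S^*$ is the unique operator in $\mathcal B_T(H)$ with $\langle Sx,y\rangle_T=\langle x,S^*y\rangle_T$ for all $x,y\in H$ (it always exists). For $S\in\mathcal B_T(H)$, $\mathcal M(S):=\{k\in A_+:\|Sx\|_{T,2}\le k\|x\|_{T,2}\text{ for all }x\in H\}$ and $\|S\|_{T,\mathrm{op}}:=\inf\mathcal M(S)$, the infimum taken in $A$. *)

theory Defs
  imports Complex_Main "HOL-Library.Lub_Glb"
begin

text \<open>A Riesz space is a lattice of class \<open>ordered_real_vector\<close>. The suprema and infima of a set
  \<open>D\<close> taken inside a subset \<open>F\<close> are expressed by \<open>isLub F D\<close> and \<open>isGlb F D\<close>.\<close>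

class unital_f_algebra = ordered_real_vector + lattice + real_algebra_1 +
  assumes f_algebra_mult_nonneg: "0 \<le> x \<Longrightarrow> 0 \<le> y \<Longrightarrow> 0 \<le> x * y"
    and f_algebra_left: "inf x y = 0 \<Longrightarrow> 0 \<le> z \<Longrightarrow> inf (z * x) y = 0"
    and f_algebra_right: "inf x y = 0 \<Longrightarrow> 0 \<le> z \<Longrightarrow> inf (x * z) y = 0"

text \<open>Universally complete means Dedekind complete (\<open>conditionally_complete_lattice\<close>) and laterally
  complete: sets of pairwise disjoint positive elements have suprema. Under Dedekind completeness
  having a supremum is the same as being bounded above.\<close>

class universally_complete_f_algebra = unital_f_algebra + conditionally_complete_lattice +
  assumes laterally_complete:
    "(\<forall>x\<in>D. 0 \<le> x) \<Longrightarrow> (\<forall>x\<in>D. \<forall>y\<in>D. x \<noteq> y \<longrightarrow> inf x y = 0) \<Longrightarrow> bdd_above D"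

definition riesz_subspace :: "'a::{ordered_real_vector,lattice} set \<Rightarrow> bool" where
  "riesz_subspace F \<longleftrightarrow> subspace F \<and> (\<forall>x\<in>F. \<forall>y\<in>F. inf x y \<in> F \<and> sup x y \<in> F)"

definition dedekind_complete :: "'a::order set \<Rightarrow> bool" where
  "dedekind_complete F \<longleftrightarrow>
     (\<forall>D\<subseteq>F. D \<noteq> {} \<and> (\<exists>u. isUb F D u) \<longrightarrow> (\<exists>s. isLub F D s))"

definition order_dense :: "'a::{ordered_real_vector,lattice} set \<Rightarrow> bool" where
  "order_dense F \<longleftrightarrow> (\<forall>x>0. \<exists>y\<in>F. 0 < y \<and> y \<le> x)"

definition weak_order_unit :: "'a::{ordered_real_vector,lattice} set \<Rightarrow> 'a \<Rightarrow> bool" where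
  "weak_order_unit F u \<longleftrightarrow> u \<in> F \<and> 0 < u \<and> (\<forall>x\<in>F. 0 \<le> x \<and> inf x u = 0 \<longrightarrow> x = 0)"

text \<open>Monotone nets are represented by their ranges, which are directed sets; only the supremum or
  infimum of a monotone net is ever used, and this depends on the range alone.\<close>

definition directed_up :: "'a::order set \<Rightarrow> bool" where
  "directed_up D \<longleftrightarrow> D \<noteq> {} \<and> (\<forall>x\<in>D. \<forall>y\<in>D. \<exists>z\<in>D. x \<le> z \<and> y \<le> z)"

definition directed_down :: "'a::order set \<Rightarrow> bool" where
  "directed_down D \<longleftrightarrow> D \<noteq> {} \<and> (\<forall>x\<in>D. \<forall>y\<in>D. \<exists>z\<in>D. z \<le> x \<and> z \<le> y)"

text \<open>The ambient type is the universal completion of \<open>E\<close>, i.e. a universally complete Riesz space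
  containing \<open>E\<close> as an order dense Riesz subspace. Its multiplicative unit \<open>1\<close> is the weak order
  unit \<open>e\<close> of \<open>E\<close>. The values of \<open>T\<close> outside \<open>E\<close> are irrelevant.\<close>

locale riesz_conditional_expectation =
  fixes E :: "'a::universally_complete_f_algebra set" and T :: "'a \<Rightarrow> 'a"
  assumes E_riesz_subspace: "riesz_subspace E"
    and E_dedekind_complete: "dedekind_complete E"
    and E_order_dense: "order_dense E"
    and one_weak_order_unit: "weak_order_unit E 1"
    and T_maps: "x \<in> E \<Longrightarrow> T x \<in> E"
    and T_add: "x \<in> E \<Longrightarrow> y \<in> E \<Longrightarrow> T (x + y) = T x + T y"
    and T_scaleR: "x \<in> E \<Longrightarrow> T (c *\<^sub>R x) = c *\<^sub>R T x"
    and T_positive: "x \<in> E \<Longrightarrow> 0 \<le> x \<Longrightarrow> 0 \<le> T x"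
    and T_projection: "x \<in> E \<Longrightarrow> T (T x) = T x"
    and T_order_continuous:
      "D \<subseteq> E \<Longrightarrow> directed_down D \<Longrightarrow> isGlb E D 0 \<Longrightarrow> isGlb E (T ` D) 0"
    and T_range_riesz_subspace: "riesz_subspace (T ` E)"
    and T_range_dedekind_complete: "dedekind_complete (T ` E)"
    and T_weak_order_unit: "weak_order_unit E u \<Longrightarrow> weak_order_unit E (T u)"
    and T_one: "T 1 = 1"
    and T_strictly_positive: "x \<in> E \<Longrightarrow> 0 \<le> x \<Longrightarrow> T x = 0 \<Longrightarrow> x = 0"

text \<open>\<open>approximates E T D f\<close>: the net \<open>D\<close> in \<open>E\<^sub>+\<close> increases to \<open>f\<close> in the universal completion and
  has images under \<open>T\<close> that are bounded above there.\<close>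

definition approximates ::
    "'a::universally_complete_f_algebra set \<Rightarrow> ('a \<Rightarrow> 'a) \<Rightarrow> 'a set \<Rightarrow> 'a \<Rightarrow> bool" where
  "approximates E T D f \<longleftrightarrow>
     D \<subseteq> E \<and> (\<forall>d\<in>D. 0 \<le> d) \<and> directed_up D \<and> isLub UNIV D f \<and> bdd_above (T ` D)"

definition L1_pos ::
    "'a::universally_complete_f_algebra set \<Rightarrow> ('a \<Rightarrow> 'a) \<Rightarrow> 'a set" where
  "L1_pos E T = {f. 0 \<le> f \<and> (\<exists>D. approximates E T D f)}"

definition L1 :: "'a::universally_complete_f_algebra set \<Rightarrow> ('a \<Rightarrow> 'a) \<Rightarrow> 'a set" where
  "L1 E T = {f - g | f g. f \<in> L1_pos E T \<and> g \<in> L1_pos E T}"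

text \<open>The value of \<open>ext_pos\<close> does not depend on the approximating net, and that of \<open>ext\<close> does not
  depend on the decomposition.\<close>

definition ext_pos ::
    "'a::universally_complete_f_algebra set \<Rightarrow> ('a \<Rightarrow> 'a) \<Rightarrow> 'a \<Rightarrow> 'a" where
  "ext_pos E T f = (THE s. \<exists>D. approximates E T D f \<and> s = Sup (T ` D))"

definition ext ::
    "'a::universally_complete_f_algebra set \<Rightarrow> ('a \<Rightarrow> 'a) \<Rightarrow> 'a \<Rightarrow> 'a" where
  "ext E T h = (THE s. \<exists>f\<in>L1_pos E T. \<exists>g\<in>L1_pos E T.
     h = f - g \<and> s = ext_pos E T f - ext_pos E T g)"

definition range_alg ::
    "'a::universally_complete_f_algebra set \<Rightarrow> ('a \<Rightarrow> 'a) \<Rightarrow> 'a set" where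
  "range_alg E T = ext E T ` L1 E T"

definition L2 :: "'a::universally_complete_f_algebra set \<Rightarrow> ('a \<Rightarrow> 'a) \<Rightarrow> 'a set" where
  "L2 E T = {x \<in> L1 E T. x\<^sup>2 \<in> L1 E T}"

definition inner_T ::
    "'a::universally_complete_f_algebra set \<Rightarrow> ('a \<Rightarrow> 'a) \<Rightarrow> 'a \<Rightarrow> 'a \<Rightarrow> 'a" where
  "inner_T E T x y = ext E T (x * y)"

definition norm_T ::
    "'a::universally_complete_f_algebra set \<Rightarrow> ('a \<Rightarrow> 'a) \<Rightarrow> 'a \<Rightarrow> 'a" where
  "norm_T E T x = (THE r. r \<in> range_alg E T \<and> 0 \<le> r \<and> r\<^sup>2 = ext E T (x\<^sup>2))"

definition op_bounds ::
    "'a::universally_complete_f_algebra set \<Rightarrow> ('a \<Rightarrow> 'a) \<Rightarrow> ('a \<Rightarrow> 'a) \<Rightarrow> 'a set" where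
  "op_bounds E T S = {k \<in> range_alg E T. 0 \<le> k \<and>
     (\<forall>x\<in>L2 E T. norm_T E T (S x) \<le> k * norm_T E T x)}"

text \<open>Operators on \<open>L2 E T\<close> are functions on the ambient type whose values outside \<open>L2 E T\<close> are
  irrelevant.\<close>

definition bounded_ops ::
    "'a::universally_complete_f_algebra set \<Rightarrow> ('a \<Rightarrow> 'a) \<Rightarrow> ('a \<Rightarrow> 'a) set" where
  "bounded_ops E T = {S.
     (\<forall>x\<in>L2 E T. S x \<in> L2 E T) \<and>
     (\<forall>x\<in>L2 E T. \<forall>y\<in>L2 E T. S (x + y) = S x + S y) \<and>
     (\<forall>a\<in>range_alg E T. \<forall>x\<in>L2 E T. S (a * x) = a * S x) \<and>
     op_bounds E T S \<noteq> {}}"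

definition op_norm_T ::
    "'a::universally_complete_f_algebra set \<Rightarrow> ('a \<Rightarrow> 'a) \<Rightarrow> ('a \<Rightarrow> 'a) \<Rightarrow> 'a" where
  "op_norm_T E T S = (THE m. isGlb (range_alg E T) (op_bounds E T S) m)"

definition is_adjoint ::
    "'a::universally_complete_f_algebra set \<Rightarrow> ('a \<Rightarrow> 'a) \<Rightarrow> ('a \<Rightarrow> 'a) \<Rightarrow> ('a \<Rightarrow> 'a) \<Rightarrow> bool" where
  "is_adjoint E T S R \<longleftrightarrow> R \<in> bounded_ops E T \<and>
     (\<forall>x\<in>L2 E T. \<forall>y\<in>L2 E T. inner_T E T (S x) y = inner_T E T x (R y))"

end

theory Submission
  imports Defs "HOL-Library.Lattice_Algebras"
begin

text \<open>The operators \<open>S\<close> and \<open>S\<^sup>*\<close> have the same set of bounds \<open>k\<close>, hence the same norm. Indeed, if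
  \<open>k\<close> bounds \<open>S\<close>, then \<open>P = T((S\<^sup>*y)\<^sup>2) = T((S S\<^sup>*y) y)\<close> satisfies
  \<open>P\<^sup>2 \<le> T((S S\<^sup>*y)\<^sup>2) T(y\<^sup>2) \<le> k\<^sup>2 P T(y\<^sup>2)\<close> by Cauchy--Schwarz, so \<open>P \<le> k\<^sup>2 T(y\<^sup>2)\<close>.
  The Cauchy--Schwarz inequality only uses real multipliers: \<open>0 \<le> T((t x - y)\<^sup>2)\<close> for all real
  \<open>t\<close>, followed by the discriminant criterion in an Archimedean unital \<open>f\<close>-algebra. No
  representation theorem is needed for the latter; commutativity of the multiplication and the
  discriminant criterion both follow from an argument on fine grids.\<close>

section \<open>Archimedean unital f-algebras\<close>

text \<open>Pointwise statements become disjointness statements: to prove \<open>w \<le> 0\<close>,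
  one works with \<open>pprt w\<close>, multiplies inequalities by elements supported where the
  required sign holds, and ends with an element of square zero or with an Archimedean limit.
  Division by \<open>P\<close> in the final estimate becomes a cancellation lemma: where
  \<open>P\<close> vanishes, the desired upper bound for \<open>P\<close> is trivial. Two further
  obstacles come from definite descriptions. \<open>ext\<close> requires independence of the
  approximating net, which rests on the order continuity of \<open>T\<close>. \<open>norm_T\<close>
  requires square roots that lie in the range of \<open>T\<close>; they are built as infima, and so
  multiplication has to commute with infima.\<close>

text \<open>These simplification rules would turn differences such as \<open>d - inf d a\<close>
  into sums with suprema; the arguments below rely on the difference form.\<close>

declare neg_inf_eq_sup [simp del] neg_sup_eq_inf [simp del] diff_inf_eq_sup [simp del]
  diff_sup_eq_inf [simp del]

instance unital_f_algebra \<subseteq> lattice_ab_group_add ..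

instance unital_f_algebra \<subseteq> ordered_ring
proof
  fix a b c :: 'a
  assume "a \<le> b" "0 \<le> c"
  then have "0 \<le> c * (b - a)" "0 \<le> (b - a) * c"
    by (auto intro: f_algebra_mult_nonneg)
  then show "c * a \<le> c * b" "a * c \<le> b * c"
    by (auto simp: algebra_simps)
qed

section \<open>Positive parts and disjointness in lattice-ordered groups\<close>

text \<open>Negative parts are written \<open>pprt (- x)\<close> throughout, so that they are
  nonnegative, unlike \<open>nprt x\<close>.\<close>

lemma inf_pprt_pprt_uminus: "inf (pprt x) (pprt (- x)) = (0 :: 'a::lattice_ab_group_add)"
proof -
  have "inf (pprt x) (pprt (- x)) = inf (pprt x + 0) (pprt x + (- x))"
    using prts[of x] by (metis add.commute add_0 add_diff_cancel_right' pprt_neg uminus_add_conv_diff)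
  also have "\<dots> = pprt x + inf 0 (- x)"
    by (simp only: add_inf_distrib_left)
  also have "inf 0 (- x) = - pprt x"
    by (simp add: pprt_def inf_eq_neg_sup sup_commute)
  finally show ?thesis by simp
qed

lemma pprt_diff_pprt_uminus: "pprt x - pprt (- x) = (x :: 'a::lattice_ab_group_add)"
  using prts[of x] by (simp add: pprt_neg)

lemma le_pprt: "x \<le> pprt (x :: 'a::lattice_ab_group_add)"
  by (simp add: pprt_def)

lemma pprt_least: "x \<le> y \<Longrightarrow> 0 \<le> y \<Longrightarrow> pprt x \<le> (y :: 'a::lattice_ab_group_add)"
  by (simp add: pprt_def)

lemma inf_add_le:
  fixes p q r :: "'a::lattice_ab_group_add"
  assumes "0 \<le> p" "0 \<le> q" "0 \<le> r"
  shows "inf (p + q) r \<le> inf p r + inf q r"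
proof -
  have "inf p r + inf q r = inf (inf (p + q) (r + q)) (inf (p + r) (r + r))"
    by (simp only: add_inf_distrib_right add_inf_distrib_left inf_assoc)
  moreover have "r \<le> r + q" "r \<le> p + r" "r \<le> r + r"
    using assms by auto
  ultimately show ?thesis
    by (auto intro: le_infI1 le_infI2)
qed

lemma inf_add_eq_0:
  fixes p q r :: "'a::lattice_ab_group_add"
  assumes "0 \<le> p" "0 \<le> q" "0 \<le> r" "inf p r = 0" "inf q r = 0"
  shows "inf (p + q) r = 0"
  using inf_add_le[of p q r] assms by (intro order.antisym) auto

lemma inf_eq_0_mono:
  fixes p q r s :: "'a::lattice_ab_group_add"
  assumes "inf p q = 0" "0 \<le> r" "r \<le> p" "0 \<le> s" "s \<le> q"
  shows "inf r s = 0"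
  using assms inf_mono[of r p s q] by (intro order.antisym) auto

text \<open>A substitute for a partition into cells: if \<open>v\<close> vanishes where \<open>z\<close> lies strictly between two
  consecutive grid points and where \<open>z\<close> is a grid point, then \<open>v\<close> vanishes wherever \<open>z\<close> lies inside
  the grid.\<close>

lemma grid_disjoint:
  fixes v z :: "'a::lattice_ab_group_add" and a :: "nat \<Rightarrow> 'a"
  assumes v: "0 \<le> v"
    and cell: "\<And>n. inf v (inf (pprt (z - a n)) (pprt (a (Suc n) - z))) = 0"
    and node: "\<And>c n. 0 \<le> c \<Longrightarrow> c \<le> v \<Longrightarrow> inf c (pprt (z - a n)) = 0 \<Longrightarrow>
      inf c (pprt (a n - z)) = 0 \<Longrightarrow> c = 0"
  shows "inf v (inf (pprt (z - a 0)) (pprt (a n - z))) = 0"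
proof (induction n)
  case 0
  have "inf (pprt (z - a 0)) (pprt (a 0 - z)) = 0"
    using inf_pprt_pprt_uminus[of "z - a 0"] by simp
  then show ?case using v by (simp add: inf_absorb2)
next
  case (Suc n)
  \<comment> \<open>The induction hypothesis makes \<open>c\<close> disjoint from the region
    \<open>z < a n\<close>, the cell hypothesis from \<open>z > a n\<close>. What is left of
    \<open>c\<close> sits where \<open>z\<close> equals the grid point \<open>a n\<close>, which
    \<open>node\<close> excludes.\<close>
  define c where "c = inf v (inf (pprt (z - a 0)) (pprt (a (Suc n) - z)))"
  have c: "0 \<le> c" "c \<le> v" using v by (auto simp: c_def)
  have "inf c (pprt (a n - z)) \<le> inf v (inf (pprt (z - a 0)) (pprt (a n - z)))"
    by (auto simp: c_def intro: le_infI1 le_infI2)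
  then have 1: "inf c (pprt (a n - z)) = 0"
    using Suc c by (intro order.antisym) auto
  have "inf c (pprt (z - a n)) \<le> inf v (inf (pprt (z - a n)) (pprt (a (Suc n) - z)))"
    by (auto simp: c_def intro: le_infI1 le_infI2)
  then have 2: "inf c (pprt (z - a n)) = 0"
    using cell[of n] c by (intro order.antisym) auto
  show ?case using node[OF c 2 1] by (simp add: c_def)
qed

section \<open>The Archimedean property\<close>

text \<open>Adding \<open>x\<close> maps the set \<open>D\<close> of multiples into itself, so
  \<open>Sup D - x\<close> is again an upper bound of \<open>D\<close>.\<close>

lemma archimedean_nonpos:
  fixes x y :: "'a::{ordered_real_vector, conditionally_complete_lattice}"
  assumes "\<And>n::nat. real n *\<^sub>R x \<le> y"
  shows "x \<le> 0"
proof -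
  define D where "D = range (\<lambda>n::nat. real n *\<^sub>R x)"
  have bdd: "bdd_above D" using assms by (auto simp: D_def bdd_above_def)
  have "d \<le> Sup D - x" if d: "d \<in> D" for d
  proof -
    obtain n :: nat where n: "d = real n *\<^sub>R x" using d by (auto simp: D_def)
    have "real (Suc n) *\<^sub>R x \<le> Sup D" using bdd unfolding D_def by (intro cSup_upper rangeI)
    then show ?thesis by (simp add: n algebra_simps)
  qed
  then have "Sup D \<le> Sup D - x" by (intro cSup_least) (auto simp: D_def)
  then show ?thesis by simp
qed

lemma archimedean_eps_nonpos:
  fixes x y :: "'a::{ordered_real_vector, conditionally_complete_lattice}"
  assumes "\<And>\<epsilon>::real. \<epsilon> > 0 \<Longrightarrow> x \<le> \<epsilon> *\<^sub>R y"
  shows "x \<le> 0"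
proof (rule archimedean_nonpos)
  fix n :: nat
  have y: "real n *\<^sub>R x \<le> y" if "n > 0" for n :: nat
    using scaleR_left_mono[OF assms[of "1 / real n"], of "real n"] that by simp
  \<comment> \<open>The multiple with \<open>n = 0\<close> is not covered by
    \<open>\<epsilon> = 1 / n\<close>, and \<open>y\<close> need not be nonnegative.\<close>
  have "0 \<le> sup y 0" by simp
  then show "real n *\<^sub>R x \<le> sup y 0"
    using y[of n] by (cases "n = 0") (auto intro: le_supI1)
qed

section \<open>Disjointness, squares and localisation in f-algebras\<close>

text \<open>Multiplying one factor at a time makes the product disjoint first from \<open>y\<close>
  and then from itself.\<close>

lemma f_algebra_mult_eq_0:
  fixes x y :: "'a::unital_f_algebra"
  assumes "inf x y = 0"
  shows "x * y = 0" "y * x = 0"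
proof -
  have nn: "0 \<le> x" "0 \<le> y" using assms by (metis inf_le1 inf_le2)+
  have "inf (x * y) y = 0" using f_algebra_right[OF assms nn(2)] .
  then show "x * y = 0"
    using f_algebra_left[of y "x * y" x] nn by (simp add: inf_commute)
  have "inf (y * x) y = 0" using f_algebra_left[OF assms nn(2)] .
  then show "y * x = 0"
    using f_algebra_right[of y "y * x" x] nn by (simp add: inf_commute)
qed

lemma f_algebra_square_eq_pprt:
  fixes x :: "'a::unital_f_algebra"
  shows "x * x = pprt x * pprt x + pprt (- x) * pprt (- x)"
proof -
  have "x * x = (pprt x - pprt (- x)) * (pprt x - pprt (- x))"
    by (simp only: pprt_diff_pprt_uminus)
  then show ?thesis
    by (simp add: algebra_simps f_algebra_mult_eq_0[OF inf_pprt_pprt_uminus])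
qed

lemma f_algebra_square_nonneg: "0 \<le> (x :: 'a::unital_f_algebra) * x"
  unfolding f_algebra_square_eq_pprt[of x] by (intro add_nonneg_nonneg f_algebra_mult_nonneg) auto

lemma f_algebra_zero_le_one: "0 \<le> (1 :: 'a::unital_f_algebra)"
  using f_algebra_square_nonneg[of "1::'a"] by simp

text \<open>\<open>c\<close> is supported where \<open>a\<close> is positive, so it annihilates the
  negative part of \<open>a\<close>. This is how an inequality is restricted to the region where an
  element is positive.\<close>

lemma mult_pprt_of_le:
  fixes c a :: "'a::unital_f_algebra"
  assumes "0 \<le> c" "c \<le> pprt a"
  shows "c * a = c * pprt a"
proof -
  have "inf c (pprt (- a)) = 0"
    using assms by (intro inf_eq_0_mono[OF inf_pprt_pprt_uminus[of a]]) auto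
  then have "c * pprt (- a) = 0" by (rule f_algebra_mult_eq_0)
  then show ?thesis
    using arg_cong[OF pprt_diff_pprt_uminus[of a], of "\<lambda>u. c * u"] by (simp add: algebra_simps)
qed

lemma inf_one_eq_0:
  fixes c :: "'a::unital_f_algebra"
  assumes "inf c 1 = 0"
  shows "c = 0"
  using f_algebra_mult_eq_0(1)[OF assms] by simp

section \<open>Commutativity of the multiplication\<close>

text \<open>A commutator need not have a sign; the bound is nonnegative and inherits the
  disjointness relations of \<open>q\<close>.\<close>

lemma mult_diff_mult_le:
  fixes x q :: "'a::unital_f_algebra"
  assumes "0 \<le> x" "0 \<le> q"
  shows "x * q - q * x \<le> x * q + q * x" "q * x - x * q \<le> x * q + q * x"
proof -
  have "0 \<le> x * q" "0 \<le> q * x" using assms by (auto intro: f_algebra_mult_nonneg)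
  then have "0 \<le> q * x + q * x" "0 \<le> x * q + x * q" by auto
  then show "x * q - q * x \<le> x * q + q * x" "q * x - x * q \<le> x * q + q * x"
    by (auto simp: algebra_simps)
qed

lemma inf_mult_add_mult_eq_0:
  fixes x q h :: "'a::unital_f_algebra"
  assumes "0 \<le> x" "inf q h = 0"
  shows "inf (x * q + q * x) h = 0"
proof -
  have "0 \<le> q" "0 \<le> h" using assms by (metis inf_le1 inf_le2)+
  then show ?thesis
    using assms by (intro inf_add_eq_0 f_algebra_mult_nonneg f_algebra_left f_algebra_right)
qed

text \<open>\<open>u \<mapsto> x * u - u * x\<close> is a difference of two band preserving maps and vanishes on the multiples
  of 1, hence is at most \<open>\<epsilon> x\<close> on each cell of an \<open>\<epsilon>\<close>-grid for \<open>y\<close>.\<close>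

lemma f_algebra_commute_nonneg:
  fixes x y :: "'a::universally_complete_f_algebra"
  assumes x: "0 \<le> x" and y: "0 \<le> y"
  shows "x * y = y * x"
proof -
  define w where "w = sup (x * y - y * x) (y * x - x * y)"
  have "w \<le> \<epsilon> *\<^sub>R x" if \<epsilon>: "\<epsilon> > 0" for \<epsilon>
  proof -
    define v where "v = pprt (w - \<epsilon> *\<^sub>R x)"
    \<comment> \<open>The grid starts at \<open>- 1\<close>, so that \<open>y - a 0\<close> is at
      least \<open>1\<close> and the lower end of the grid cuts nothing off.\<close>
    define a :: "nat \<Rightarrow> 'a" where "a n = (real n * \<epsilon> - 1) *\<^sub>R 1" for n
    have a_Suc: "a (Suc n) = a n + \<epsilon> *\<^sub>R 1" for n by (simp add: a_def algebra_simps)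
    have v: "0 \<le> v" by (simp add: v_def)
    have \<epsilon>1: "0 \<le> \<epsilon> *\<^sub>R (1::'a)" using \<epsilon> f_algebra_zero_le_one by (intro scaleR_nonneg_nonneg) auto
    have \<epsilon>x: "0 \<le> \<epsilon> *\<^sub>R x" using \<epsilon> x by (intro scaleR_nonneg_nonneg) auto
    have shift: "x * y - y * x = x * (y - a n) - (y - a n) * x" for n
      by (simp add: a_def algebra_simps)
    have grid: "inf v (inf (pprt (y - a 0)) (pprt (a n - y))) = 0" for n
    proof (rule grid_disjoint[OF v])
      fix n
      define u where "u = y - a n"
      define g where "g = pprt u"
      define h where "h = pprt (\<epsilon> *\<^sub>R 1 - u)"
      define p where "p = pprt (u - \<epsilon> *\<^sub>R 1)"
      define q where "q = pprt (- u)"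
      \<comment> \<open>\<open>m\<close> is \<open>u\<close> truncated to the interval from
        \<open>0\<close> to \<open>\<epsilon> *\<^sub>R 1\<close>, with \<open>p\<close> the excess
        above and \<open>q\<close> the deficit below it. The commutator with \<open>m\<close> is at
        most \<open>\<epsilon> *\<^sub>R x\<close>; the contributions \<open>P\<close> and
        \<open>Q\<close> of \<open>p\<close> and \<open>q\<close> are disjoint from \<open>h\<close>
        and \<open>g\<close>, hence vanish on the cell.\<close>
      define m where "m = g - p"
      have ph: "inf p h = 0"
        using inf_pprt_pprt_uminus[of "u - \<epsilon> *\<^sub>R 1"] by (simp add: p_def h_def)
      have qg: "inf q g = 0"
        using inf_pprt_pprt_uminus[of u] by (simp add: q_def g_def inf_commute)
      have u: "u = m + p - q"
        by (simp add: m_def g_def q_def pprt_diff_pprt_uminus)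
      have "p \<le> g" unfolding p_def g_def using \<epsilon>1 by (intro pprt_mono) simp
      then have m0: "0 \<le> m" by (simp add: m_def)
      have "u \<le> \<epsilon> *\<^sub>R 1 + p" using le_pprt[of "u - \<epsilon> *\<^sub>R 1"] by (simp add: p_def algebra_simps)
      then have "g \<le> \<epsilon> *\<^sub>R 1 + p" unfolding g_def using \<epsilon>1 by (intro pprt_least) (auto simp: p_def)
      then have m1: "m \<le> \<epsilon> *\<^sub>R 1" by (simp add: m_def algebra_simps)
      have xm: "x * m \<le> \<epsilon> *\<^sub>R x" "m * x \<le> \<epsilon> *\<^sub>R x"
        using mult_left_mono[OF m1 x] mult_right_mono[OF m1 x] by auto
      have xm0: "0 \<le> x * m" "0 \<le> m * x" using x m0 by (auto intro: f_algebra_mult_nonneg)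
      define P where "P = x * p + p * x"
      define Q where "Q = x * q + q * x"
      have p0: "0 \<le> p" and q0: "0 \<le> q" and g0: "0 \<le> g" and h0: "0 \<le> h"
        by (auto simp: p_def q_def g_def h_def)
      have P0: "0 \<le> P" "0 \<le> Q" unfolding P_def Q_def using x p0 q0
        by (auto intro!: add_nonneg_nonneg f_algebra_mult_nonneg)
      have "x * m - m * x \<le> \<epsilon> *\<^sub>R x" "m * x - x * m \<le> \<epsilon> *\<^sub>R x"
        using xm xm0 by (metis add_increasing2 diff_le_eq)+
      note m_bounds = this
      have "x * u - u * x = (x * m - m * x) + ((x * p - p * x) + (q * x - x * q))"
        "u * x - x * u = (m * x - x * m) + ((p * x - x * p) + (x * q - q * x))"
        by (simp_all add: u algebra_simps)
      moreover have "(x * m - m * x) + ((x * p - p * x) + (q * x - x * q)) \<le> \<epsilon> *\<^sub>R x + (P + Q)"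
        "(m * x - x * m) + ((p * x - x * p) + (x * q - q * x)) \<le> \<epsilon> *\<^sub>R x + (P + Q)"
        unfolding P_def Q_def by (intro add_mono m_bounds mult_diff_mult_le x p0 q0)+
      ultimately have "x * y - y * x \<le> \<epsilon> *\<^sub>R x + (P + Q)" "y * x - x * y \<le> \<epsilon> *\<^sub>R x + (P + Q)"
        using shift[of n] unfolding u_def[symmetric] by (metis, metis minus_diff_eq)
      then have "w \<le> \<epsilon> *\<^sub>R x + (P + Q)" by (simp add: w_def)
      then have "v \<le> P + Q"
        unfolding v_def using P0 by (intro pprt_least) (auto simp: algebra_simps)
      moreover have "inf (P + Q) (inf g h) = 0"
      proof (intro inf_add_eq_0 P0)
        have "inf P h = 0" "inf Q g = 0"
          unfolding P_def Q_def by (intro inf_mult_add_mult_eq_0 x ph qg)+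
        then show "inf P (inf g h) = 0" "inf Q (inf g h) = 0"
          using P0 g0 h0 inf_eq_0_mono[of P h P "inf g h"] inf_eq_0_mono[of Q g Q "inf g h"] by auto
      qed (use g0 h0 in auto)
      ultimately have "inf v (inf g h) = 0"
        using v g0 h0 by (intro inf_eq_0_mono[of "P + Q" "inf g h" v "inf g h"]) auto
      then show "inf v (inf (pprt (y - a n)) (pprt (a (Suc n) - y))) = 0"
        by (simp add: g_def h_def u_def a_Suc algebra_simps)
    next
      fix c n
      assume c: "0 \<le> c" "c \<le> v"
        and "inf c (pprt (y - a n)) = 0" "inf c (pprt (a n - y)) = 0"
      define g where "g = pprt (y - a n)"
      define q where "q = pprt (a n - y)"
      have c_disj: "inf g c = 0" "inf q c = 0"
        using \<open>inf c (pprt (y - a n)) = 0\<close> \<open>inf c (pprt (a n - y)) = 0\<close>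
        by (simp_all add: g_def q_def inf_commute)
      define P where "P = x * g + g * x"
      define Q where "Q = x * q + q * x"
      have q0: "0 \<le> q" and g0: "0 \<le> g" by (auto simp: q_def g_def)
      have P0: "0 \<le> P" "0 \<le> Q" unfolding P_def Q_def using x g0 q0
        by (auto intro!: add_nonneg_nonneg f_algebra_mult_nonneg)
      have u: "y - a n = g - q"
        using pprt_diff_pprt_uminus[of "y - a n"] by (simp add: g_def q_def)
      have "x * (y - a n) - (y - a n) * x = (x * g - g * x) + (q * x - x * q)"
        "(y - a n) * x - x * (y - a n) = (g * x - x * g) + (x * q - q * x)"
        unfolding u by (simp_all add: algebra_simps)
      moreover have "(x * g - g * x) + (q * x - x * q) \<le> P + Q"
        "(g * x - x * g) + (x * q - q * x) \<le> P + Q"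
        unfolding P_def Q_def by (intro add_mono mult_diff_mult_le x g0 q0)+
      ultimately have "x * y - y * x \<le> P + Q" "y * x - x * y \<le> P + Q"
        using shift[of n] by (metis, metis minus_diff_eq)
      then have "w \<le> P + Q" by (simp add: w_def)
      then have "v \<le> P + Q"
        unfolding v_def using P0 \<epsilon>x by (intro pprt_least) (auto simp: algebra_simps intro: order_trans)
      then have "c \<le> P + Q" using c by simp
      moreover have "inf (P + Q) c = 0"
        unfolding P_def Q_def using P0 c
        by (intro inf_add_eq_0 inf_mult_add_mult_eq_0 x c_disj) (auto simp: P_def Q_def)
      ultimately show "c = 0" by (simp add: inf_absorb2)
    qed
    \<comment> \<open>By \<open>grid\<close>, \<open>y\<close> is at least every grid point on the
      support of \<open>v\<close>, although the grid points are unbounded. The extra summand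
      \<open>v\<close> compensates for the start at \<open>- 1\<close>.\<close>
    have "real n *\<^sub>R (\<epsilon> *\<^sub>R v) \<le> v + v * y" for n
    proof -
      have "1 \<le> pprt (y - a 0)"
        using y by (intro order_trans[OF _ le_pprt]) (simp add: a_def)
      then have "inf 1 (inf v (pprt (a n - y))) \<le> inf v (inf (pprt (y - a 0)) (pprt (a n - y)))"
        by (auto intro: le_infI1 le_infI2)
      then have "inf (inf v (pprt (a n - y))) 1 = 0"
        using grid[of n] v f_algebra_zero_le_one by (intro order.antisym) (auto simp: inf_commute)
      then have "inf v (pprt (a n - y)) = 0" by (rule inf_one_eq_0)
      then have "v * pprt (a n - y) = 0" by (rule f_algebra_mult_eq_0)
      then have "v * (a n - y) \<le> 0"
        using mult_left_mono[OF le_pprt[of "a n - y"] v] by simp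
      then show ?thesis by (simp add: a_def algebra_simps)
    qed
    then have "\<epsilon> *\<^sub>R v \<le> 0" by (rule archimedean_nonpos)
    then have "v \<le> 0" using scaleR_left_mono[of "\<epsilon> *\<^sub>R v" 0 "1 / \<epsilon>"] \<epsilon> by simp
    then have "w - \<epsilon> *\<^sub>R x \<le> 0" using le_pprt[of "w - \<epsilon> *\<^sub>R x"] unfolding v_def by (rule order_trans[rotated])
    then show ?thesis by simp
  qed
  then have "w \<le> 0" by (rule archimedean_eps_nonpos)
  then show ?thesis by (simp add: w_def order.antisym)
qed

instance universally_complete_f_algebra \<subseteq> comm_ring_1
proof
  fix x y z :: 'a
  have nn: "pprt u * pprt u' = pprt u' * pprt u" for u u' :: 'a
    by (intro f_algebra_commute_nonneg) auto
  have "(pprt x - pprt (- x)) * (pprt y - pprt (- y)) = (pprt y - pprt (- y)) * (pprt x - pprt (- x))"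
    by (simp only: left_diff_distrib right_diff_distrib nn) (simp add: algebra_simps)
  then show "x * y = y * x"
    by (simp only: pprt_diff_pprt_uminus)
qed (auto simp: algebra_simps)

section \<open>Absence of nilpotents, cancellation and the discriminant criterion\<close>

text \<open>If \<open>y * y = 0\<close>, the square of \<open>n y - 1/2\<close> collapses to
  \<open>1/4 - n y\<close>. Since it is nonnegative for every \<open>n\<close>, the Archimedean
  property gives \<open>y \<le> 0\<close>; the same applies to \<open>- y\<close>.\<close>

lemma f_algebra_reduced:
  fixes x :: "'a::universally_complete_f_algebra"
  assumes "x * x \<le> 0"
  shows "x = 0"
proof -
  have xx: "x * x = 0" using assms f_algebra_square_nonneg[of x] by simp
  have *: "y \<le> 0" if yy: "y * y = 0" for y :: 'a
  proof (rule archimedean_nonpos)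
    fix n :: nat
    have "0 \<le> (real n *\<^sub>R y - (1/2) *\<^sub>R 1) * (real n *\<^sub>R y - (1/2) *\<^sub>R 1)"
      by (rule f_algebra_square_nonneg)
    also have "\<dots> = (1/4) *\<^sub>R 1 - ((real n / 2) *\<^sub>R y + (real n / 2) *\<^sub>R y)"
      by (simp add: algebra_simps yy)
    also have "(real n / 2) *\<^sub>R y + (real n / 2) *\<^sub>R y = real n *\<^sub>R y"
      by (simp flip: scaleR_left_distrib)
    finally show "real n *\<^sub>R y \<le> (1/4) *\<^sub>R 1" by simp
  qed
  have "x \<le> 0" "- x \<le> 0" using *[of x] *[of "- x"] xx by simp_all
  then show ?thesis by (intro order.antisym) simp_all
qed

lemma f_algebra_cube_nonpos:
  fixes p :: "'a::universally_complete_f_algebra"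
  assumes "0 \<le> p" "p * p * p \<le> 0"
  shows "p = 0"
proof -
  have "(p * p) * (p * p) \<le> 0"
    using mult_right_mono[OF assms(2,1)] by (simp add: mult.assoc)
  then have "p * p = 0" by (rule f_algebra_reduced)
  then show ?thesis by (simp add: f_algebra_reduced)
qed

lemma inf_eq_0_of_mult_eq_0:
  fixes x y :: "'a::universally_complete_f_algebra"
  assumes "0 \<le> x" "0 \<le> y" "x * y = 0"
  shows "inf x y = 0"
proof (rule f_algebra_reduced)
  have "inf x y * inf x y \<le> x * y" using assms by (intro mult_mono') auto
  then show "inf x y * inf x y \<le> 0" using assms by simp
qed

text \<open>Cancellation of \<open>b\<close> without an inverse: \<open>w \<le> b\<close> forces
  \<open>b\<close> to be positive wherever \<open>w\<close> is. It serves both to compare square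
  roots and to divide by \<open>P\<close> in the adjoint estimate.\<close>

lemma f_algebra_nonpos_of_mult_nonpos:
  fixes w b :: "'a::universally_complete_f_algebra"
  assumes "w * b \<le> 0" "w \<le> b" "0 \<le> b"
  shows "w \<le> 0"
proof -
  define p where "p = pprt w"
  have p: "0 \<le> p" "p \<le> b" using assms by (auto simp: p_def intro: pprt_least)
  have "p * p * p \<le> p * p * b" using p by (intro mult_left_mono) auto
  also have "\<dots> = p * (w * b)" using mult_pprt_of_le[of p w] p by (simp add: p_def flip: mult.assoc)
  also have "\<dots> \<le> 0" using mult_left_mono[OF assms(1) p(1)] by simp
  finally have "p = 0" using p by (intro f_algebra_cube_nonpos)
  then show ?thesis using le_pprt[of w] by (simp add: p_def)
qed

lemma f_algebra_square_le_imp_le: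
  fixes r s :: "'a::universally_complete_f_algebra"
  assumes "r * r \<le> s * s" "0 \<le> r" "0 \<le> s"
  shows "r \<le> s"
proof -
  have "(r - s) * (r + s) \<le> 0" using assms(1) by (simp add: algebra_simps)
  moreover have "r - s \<le> r + s"
    using assms(3) add_increasing[of s s s] by (simp add: diff_le_eq add.assoc)
  moreover have "0 \<le> r + s" using assms by simp
  ultimately have "r - s \<le> 0" by (rule f_algebra_nonpos_of_mult_nonpos)
  then show ?thesis by simp
qed

text \<open>If \<open>d \<le> (t X - z)\<^sup>2\<close> for all real \<open>t\<close>, then \<open>z\<close> stays away from all multiples of \<open>X\<close> on
  the support of \<open>d\<close>, which is only possible where \<open>X\<close> or \<open>z\<close> vanishes.\<close>

lemma mult_eq_0_of_le_squares:
  fixes d X z :: "'a::universally_complete_f_algebra"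
  assumes d: "0 \<le> d" "d \<le> z * z" and X: "0 \<le> X" and z: "0 \<le> z"
    and le: "\<And>t::real. 0 \<le> t \<Longrightarrow> d \<le> (z - t *\<^sub>R X) * (z - t *\<^sub>R X)"
  shows "d * X = 0"
proof -
  have "d * X \<le> \<delta> *\<^sub>R (X * X * X)" if \<delta>: "\<delta> > 0" for \<delta>
  proof -
    \<comment> \<open>With mesh \<open>\<epsilon> *\<^sub>R X\<close>, the squared distance to a
      grid point inside a cell is at most \<open>\<delta> *\<^sub>R (X * X)\<close>. The part
      \<open>v\<close> lives where \<open>d\<close> exceeds this value, so it must avoid every
      cell.\<close>
    define \<epsilon> where "\<epsilon> = sqrt \<delta>"
    have \<epsilon>: "\<epsilon> > 0" "\<epsilon> * \<epsilon> = \<delta>" using \<delta> by (auto simp: \<epsilon>_def)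
    have XX: "0 \<le> \<delta> *\<^sub>R (X * X)" using \<delta> X by (intro scaleR_nonneg_nonneg mult_nonneg_nonneg) auto
    define v where "v = pprt (d - \<delta> *\<^sub>R (X * X))"
    have v: "0 \<le> v" "v \<le> d" unfolding v_def using d XX by (auto intro: pprt_least)
    define a where "a n = (real n * \<epsilon>) *\<^sub>R X" for n
    have a_Suc: "a (Suc n) = a n + \<epsilon> *\<^sub>R X" for n by (simp add: a_def algebra_simps)
    have le_a: "d \<le> (z - a n) * (z - a n)" for n using le[of "real n * \<epsilon>"] \<epsilon> by (simp add: a_def)
    have grid: "inf v (inf (pprt (z - a 0)) (pprt (a n - z))) = 0" for n
    proof (rule grid_disjoint[OF v(1)])
      fix n
      define u where "u = z - a n"
      define c where "c = inf v (inf (pprt u) (pprt (\<epsilon> *\<^sub>R X - u)))"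
      have c: "0 \<le> c" "c \<le> v" "c \<le> pprt u" "c \<le> pprt (\<epsilon> *\<^sub>R X - u)"
        using v by (auto simp: c_def intro: le_infI1 le_infI2)
      have "0 \<le> c * (\<epsilon> *\<^sub>R X - u)"
        using mult_pprt_of_le[OF c(1,4)] c by (simp add: mult_nonneg_nonneg)
      then have cu: "c * u \<le> c * (\<epsilon> *\<^sub>R X)" by (simp add: right_diff_distrib)
      have cu_pprt: "c * u = c * pprt u" by (rule mult_pprt_of_le[OF c(1,3)])
      have "c * d \<le> c * (u * u)" using le_a[of n] c by (intro mult_left_mono) (auto simp: u_def)
      also have "\<dots> = (c * u) * u" by (simp add: mult.assoc)
      also have "\<dots> = (c * u) * pprt u" using cu_pprt by (metis mult.assoc mult.commute)
      also have "\<dots> \<le> c * (\<epsilon> *\<^sub>R X) * pprt u" using cu by (intro mult_right_mono) auto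
      also have "\<dots> = (c * u) * (\<epsilon> *\<^sub>R X)" using cu_pprt by (metis mult.assoc mult.commute)
      also have "\<dots> \<le> (c * (\<epsilon> *\<^sub>R X)) * (\<epsilon> *\<^sub>R X)"
        using cu \<epsilon> X by (intro mult_right_mono scaleR_nonneg_nonneg) auto
      also have "\<dots> = c * (\<delta> *\<^sub>R (X * X))" by (simp add: \<epsilon>(2)[symmetric] mult.assoc)
      finally have "c * (d - \<delta> *\<^sub>R (X * X)) \<le> 0" by (simp add: right_diff_distrib)
      moreover have "c * (d - \<delta> *\<^sub>R (X * X)) = c * v"
        using c unfolding v_def by (intro mult_pprt_of_le)
      moreover have "c * c \<le> c * v" using c by (intro mult_left_mono) auto
      ultimately have "c = 0" by (intro f_algebra_reduced) auto
      then show "inf v (inf (pprt (z - a n)) (pprt (a (Suc n) - z))) = 0"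
        by (simp add: c_def u_def a_Suc algebra_simps)
    next
      fix c n
      assume c: "0 \<le> c" "c \<le> v"
        and disj: "inf c (pprt (z - a n)) = 0" "inf c (pprt (a n - z)) = 0"
      have "c * (z - a n) = c * pprt (z - a n) - c * pprt (a n - z)"
        using pprt_diff_pprt_uminus[of "z - a n"] by (simp flip: right_diff_distrib)
      also have "\<dots> = 0" using disj by (simp add: f_algebra_mult_eq_0)
      finally have "c * (z - a n) = 0" .
      then have "c * ((z - a n) * (z - a n)) = 0" by (simp flip: mult.assoc)
      moreover have "c * d \<le> c * ((z - a n) * (z - a n))"
        using le_a[of n] c by (intro mult_left_mono)
      moreover have "c * c \<le> c * d" using c v by (intro mult_left_mono) auto
      ultimately show "c = 0" by (intro f_algebra_reduced) auto
    qed
    \<comment> \<open>The grid starts at \<open>a 0 = 0\<close>, so \<open>grid\<close> controls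
      \<open>v\<close> only where \<open>z\<close> is positive, which \<open>b\<close> isolates.
      There \<open>z\<close> dominates all multiples of \<open>\<epsilon> *\<^sub>R X\<close>, so
      \<open>b * X\<close> vanishes.\<close>
    define b where "b = inf v z"
    have b: "0 \<le> b" "b \<le> z" "b \<le> v" using v z by (auto simp: b_def)
    have "b * X \<le> 0"
    proof -
      have "real n *\<^sub>R (\<epsilon> *\<^sub>R (b * X)) \<le> b * z" for n
      proof -
        have "inf b (pprt (a n - z)) = 0"
          using grid[of n] z by (simp add: b_def a_def inf_assoc)
        then have "b * pprt (a n - z) = 0" by (rule f_algebra_mult_eq_0)
        then have "b * (a n - z) \<le> 0"
          using mult_left_mono[OF le_pprt[of "a n - z"] b(1)] by simp
        then show ?thesis by (simp add: a_def right_diff_distrib)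
      qed
      then have "\<epsilon> *\<^sub>R (b * X) \<le> 0" by (rule archimedean_nonpos)
      then show ?thesis using scaleR_left_mono[of "\<epsilon> *\<^sub>R (b * X)" 0 "1 / \<epsilon>"] \<epsilon> by simp
    qed
    then have "b * X = 0" using b X by (simp add: order.antisym mult_nonneg_nonneg)
    then have "inf b X = 0" using b X by (intro inf_eq_0_of_mult_eq_0)
    \<comment> \<open>\<open>inf v X\<close> is disjoint from \<open>z\<close> and yet lies below
      \<open>d \<le> z * z\<close>, so its square vanishes.\<close>
    then have "inf (inf v X) z = 0" by (simp add: b_def inf_aci)
    then have vXz: "inf v X * z = 0" by (rule f_algebra_mult_eq_0)
    have "inf v X * inf v X \<le> inf v X * (z * z)"
      using v X d by (intro mult_left_mono) (auto intro: le_infI1 order_trans)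
    also have "\<dots> = 0" using vXz by (simp flip: mult.assoc)
    finally have "inf v X = 0" by (rule f_algebra_reduced)
    then have "v * X = 0" by (rule f_algebra_mult_eq_0)
    moreover have "(d - \<delta> *\<^sub>R (X * X)) * X \<le> v * X"
      unfolding v_def using X by (intro mult_right_mono le_pprt)
    ultimately show ?thesis by (simp add: left_diff_distrib)
  qed
  then have "d * X \<le> 0" by (rule archimedean_eps_nonpos)
  then show ?thesis using d X by (simp add: order.antisym mult_nonneg_nonneg)
qed

text \<open>Multiplying the hypothesis by \<open>X\<close> and completing the square bounds
  \<open>z * z - X * Y\<close> by \<open>(z - t *\<^sub>R X)\<close> squared for every
  \<open>t\<close>, so the excess \<open>d\<close> is annihilated by \<open>X\<close>. On the
  support of \<open>d\<close> the hypothesis then reads \<open>(2 * t) *\<^sub>R z \<le> Y\<close>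
  for all \<open>t\<close>, so \<open>z\<close> vanishes there too, against
  \<open>d \<le> z * z\<close>.\<close>

lemma f_algebra_discriminant:
  fixes X Y z :: "'a::universally_complete_f_algebra"
  assumes X: "0 \<le> X" and Y: "0 \<le> Y" and z: "0 \<le> z"
    and le: "\<And>t::real. 0 \<le> t \<Longrightarrow> (2 * t) *\<^sub>R z \<le> (t * t) *\<^sub>R X + Y"
  shows "z * z \<le> X * Y"
proof -
  define d where "d = pprt (z * z - X * Y)"
  have XY: "0 \<le> X * Y" using X Y by (rule mult_nonneg_nonneg)
  have d: "0 \<le> d" "d \<le> z * z"
    unfolding d_def using XY f_algebra_square_nonneg[of z] by (auto intro: pprt_least)
  have "d \<le> (z - t *\<^sub>R X) * (z - t *\<^sub>R X)" if "0 \<le> t" for t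
  proof -
    have "X * ((2 * t) *\<^sub>R z) \<le> X * ((t * t) *\<^sub>R X + Y)" using le[OF that] X by (rule mult_left_mono)
    moreover have "(z - t *\<^sub>R X) * (z - t *\<^sub>R X)
        = z * z - X * ((2 * t) *\<^sub>R z) + (t * t) *\<^sub>R (X * X)"
      by (simp add: algebra_simps flip: scaleR_2)
    ultimately have "z * z - X * Y \<le> (z - t *\<^sub>R X) * (z - t *\<^sub>R X)"
      by (simp add: algebra_simps)
    then show ?thesis unfolding d_def by (intro pprt_least f_algebra_square_nonneg)
  qed
  then have dX: "d * X = 0" by (intro mult_eq_0_of_le_squares[OF d X z])
  have "2 *\<^sub>R (d * z) \<le> 0"
  proof (rule archimedean_nonpos)
    fix n :: nat
    have "d * ((2 * real n) *\<^sub>R z) \<le> d * ((real n * real n) *\<^sub>R X + Y)"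
      using le[of "real n"] d by (intro mult_left_mono) auto
    then show "real n *\<^sub>R 2 *\<^sub>R (d * z) \<le> d * Y"
      by (simp add: dX distrib_left mult.commute[of 2])
  qed
  then have "d * z \<le> 0" using scaleR_left_mono[of "2 *\<^sub>R (d * z)" 0 "1/2"] by simp
  then have dz: "d * z = 0" using d z by (simp add: order.antisym mult_nonneg_nonneg)
  have "d * d \<le> d * (z * z)" using d by (intro mult_left_mono) auto
  also have "\<dots> = 0" using dz by (simp flip: mult.assoc)
  finally have "d = 0" by (rule f_algebra_reduced)
  then show ?thesis using le_pprt[of "z * z - X * Y"] by (simp add: d_def)
qed

section \<open>Multiplication and infima; square roots\<close>

text \<open>Order continuity of multiplication by \<open>z\<close>. For a real multiple of
  \<open>1\<close> this is a scaling; \<open>z\<close> exceeds \<open>n *\<^sub>R 1\<close> by at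
  most \<open>z * z\<close> divided by \<open>n\<close>, and this error disappears as
  \<open>n\<close> grows.\<close>

lemma le_mult_Inf:
  fixes P :: "'a::universally_complete_f_algebra set"
  assumes P: "P \<noteq> {}" "\<And>p. p \<in> P \<Longrightarrow> 0 \<le> p" and z: "0 \<le> z"
    and le: "\<And>p. p \<in> P \<Longrightarrow> a \<le> z * p"
  shows "a \<le> z * Inf P"
proof -
  define s where "s = Inf P"
  define w where "w = pprt (a - z * s)"
  have bdd: "bdd_below P" using P(2) by (rule bdd_belowI)
  have sp: "s \<le> p" if "p \<in> P" for p unfolding s_def using that bdd by (rule cInf_lower)
  obtain p0 where p0: "p0 \<in> P" using P by auto
  have w: "w \<le> z * (p - s)" if "p \<in> P" for p
    unfolding w_def using le[OF that] sp[OF that] z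
    by (intro pprt_least mult_nonneg_nonneg) (auto simp: right_diff_distrib)
  define B where "B = z * z * (p0 - s)"
  have "w \<le> \<epsilon> *\<^sub>R B" if \<epsilon>: "\<epsilon> > 0" for \<epsilon>
  proof -
    define n where "n = 1 / \<epsilon>"
    have n: "n > 0" "\<epsilon> * n = 1" using \<epsilon> by (auto simp: n_def)
    define y where "y = pprt (z - n *\<^sub>R 1)"
    have y0: "0 \<le> y" by (simp add: y_def)
    have "y \<le> z" unfolding y_def using n z f_algebra_zero_le_one[where ?'a='a]
      by (intro pprt_least) (auto intro: scaleR_nonneg_nonneg)
    have y: "n *\<^sub>R y \<le> z * z"
    proof -
      have "0 \<le> y * (z - n *\<^sub>R 1)"
        using mult_pprt_of_le[of y "z - n *\<^sub>R 1"] y0 by (simp add: y_def f_algebra_square_nonneg)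
      then have "n *\<^sub>R y \<le> y * z" by (simp add: right_diff_distrib)
      also have "\<dots> \<le> z * z" using \<open>y \<le> z\<close> z by (intro mult_right_mono)
      finally show ?thesis .
    qed
    have y': "y \<le> \<epsilon> *\<^sub>R (z * z)" using scaleR_left_mono[OF y, of \<epsilon>] \<epsilon> n by simp
    have zy: "z \<le> n *\<^sub>R 1 + y" using le_pprt[of "z - n *\<^sub>R 1"] by (simp add: y_def algebra_simps)
    have "(1 / n) *\<^sub>R (w - \<epsilon> *\<^sub>R B) + s \<le> p" if p: "p \<in> P" for p
    proof -
      \<comment> \<open>Capping \<open>p\<close> by the fixed \<open>p0\<close> bounds the error
        term \<open>y * q\<close> by \<open>\<epsilon> *\<^sub>R B\<close> for all \<open>p\<close>
        at once.\<close>
      define q where "q = inf p p0 - s"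
      have q0: "0 \<le> q" unfolding q_def using sp[OF p] sp[OF p0] by simp
      have q: "q \<le> p - s" "q \<le> p0 - s"
        unfolding q_def diff_conv_add_uminus by (intro add_right_mono inf_le1 inf_le2)+
      have "w \<le> z * q"
      proof -
        \<comment> \<open>\<open>inf p p0\<close> need not belong to \<open>P\<close>.
          Multiplication by \<open>z\<close> keeps the two differences disjoint, so the bounds for
          \<open>p\<close> and \<open>p0\<close> combine into one for
          \<open>inf p p0\<close>.\<close>
        have "inf (p - inf p p0) (p0 - inf p p0) = 0"
          unfolding diff_conv_add_uminus add_inf_distrib_right[symmetric]
          by simp
        then have "inf (z * (p - inf p p0)) (p0 - inf p p0) = 0" using z by (rule f_algebra_left)
        then have "inf (p0 - inf p p0) (z * (p - inf p p0)) = 0" by (simp only: inf_commute)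
        then have 0: "inf (z * (p0 - inf p p0)) (z * (p - inf p p0)) = 0" using z by (rule f_algebra_left)
        have "w - z * q \<le> z * (p - inf p p0)" "w - z * q \<le> z * (p0 - inf p p0)"
          using w[OF p] w[OF p0] unfolding q_def by (simp_all only: right_diff_distrib) (simp_all add: algebra_simps)
        then have "w - z * q \<le> inf (z * (p0 - inf p p0)) (z * (p - inf p p0))" by simp
        then show ?thesis by (simp only: 0) simp
      qed
      also have "\<dots> \<le> (n *\<^sub>R 1 + y) * q" using zy q0 by (rule mult_right_mono)
      also have "\<dots> = n *\<^sub>R q + y * q" by (simp add: distrib_right)
      also have "\<dots> \<le> n *\<^sub>R (p - s) + (\<epsilon> *\<^sub>R (z * z)) * (p0 - s)"
        using n q q0 y' y0 sp[OF p0] z \<epsilon>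
        by (intro add_mono scaleR_left_mono mult_mono scaleR_nonneg_nonneg mult_nonneg_nonneg) auto
      also have "\<dots> = n *\<^sub>R (p - s) + \<epsilon> *\<^sub>R B" by (simp add: B_def)
      finally have "w - \<epsilon> *\<^sub>R B \<le> n *\<^sub>R (p - s)" by (simp add: diff_le_eq)
      then have "(1 / n) *\<^sub>R (w - \<epsilon> *\<^sub>R B) \<le> p - s"
        using scaleR_left_mono[of "w - \<epsilon> *\<^sub>R B" "n *\<^sub>R (p - s)" "1 / n"] n by simp
      then show ?thesis by (simp add: le_diff_eq)
    qed
    then have "(1 / n) *\<^sub>R (w - \<epsilon> *\<^sub>R B) + s \<le> s"
      unfolding s_def using P by (intro cInf_greatest)
    then have "(1 / n) *\<^sub>R (w - \<epsilon> *\<^sub>R B) \<le> 0" by simp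
    then have "w - \<epsilon> *\<^sub>R B \<le> 0"
      using scaleR_left_mono[of "(1 / n) *\<^sub>R (w - \<epsilon> *\<^sub>R B)" 0 n] n by simp
    then show ?thesis by simp
  qed
  then have "w \<le> 0" by (rule archimedean_eps_nonpos)
  then have "a - z * s \<le> 0" using le_pprt[of "a - z * s"] unfolding w_def by (rule order_trans[rotated])
  then show ?thesis by (simp add: s_def)
qed

text \<open>The infimum \<open>\<surd>a = inf\<^sub>t (t a + 1/t)/2\<close> comes from the inequality between the arithmetic and
  the geometric mean.\<close>

definition sqrt_majorants :: "'a::universally_complete_f_algebra \<Rightarrow> 'a set" where
  "sqrt_majorants a = (\<lambda>t::real. (1/2) *\<^sub>R (t *\<^sub>R a + (1 / t) *\<^sub>R 1)) ` {0<..}"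

lemma sqrt_majorants_nonempty: "sqrt_majorants a \<noteq> {}"
  by (auto simp: sqrt_majorants_def)

lemma sqrt_majorants_nonneg:
  assumes "0 \<le> a" "p \<in> sqrt_majorants a"
  shows "0 \<le> p"
  using assms f_algebra_zero_le_one[where ?'a='a]
  by (auto simp: sqrt_majorants_def intro!: scaleR_nonneg_nonneg add_nonneg_nonneg)

lemma bdd_below_sqrt_majorants: "0 \<le> a \<Longrightarrow> bdd_below (sqrt_majorants a)"
  using sqrt_majorants_nonneg by (auto simp: bdd_below_def)

text \<open>The infimum will be taken in each factor separately, so the bound is needed for two
  different parameters.\<close>

lemma le_mult_sqrt_majorants:
  fixes a :: "'a::universally_complete_f_algebra"
  assumes a: "0 \<le> a" and p: "p \<in> sqrt_majorants a" and q: "q \<in> sqrt_majorants a"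
  shows "a \<le> p * q"
proof -
  obtain t where t: "t > 0" "p = (1/2) *\<^sub>R (t *\<^sub>R a + (1 / t) *\<^sub>R 1)"
    using p by (auto simp: sqrt_majorants_def)
  obtain u where u: "u > 0" "q = (1/2) *\<^sub>R (u *\<^sub>R a + (1 / u) *\<^sub>R 1)"
    using q by (auto simp: sqrt_majorants_def)
  \<comment> \<open>This \<open>r\<close> completes the terms with \<open>a * a\<close> and
    \<open>1\<close> to a square; what remains is a multiple of \<open>a\<close> with factor at
    least \<open>4\<close>, because \<open>t / u + u / t\<close> is at least
    \<open>2\<close>.\<close>
  define r where "r = sqrt (t * u)"
  have r: "r > 0" "r * r = t * u" using t u by (auto simp: r_def)
  have "4 *\<^sub>R (p * q) = (t * u) *\<^sub>R (a * a) + (t / u + u / t) *\<^sub>R a + (1 / (t * u)) *\<^sub>R 1"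
    by (simp add: t u algebra_simps)
  also have "\<dots> = (r *\<^sub>R a - (1 / r) *\<^sub>R 1) * (r *\<^sub>R a - (1 / r) *\<^sub>R 1) + (2 + t / u + u / t) *\<^sub>R a"
    using r by (simp add: algebra_simps flip: r(2) scaleR_2)
  finally have eq: "4 *\<^sub>R (p * q) = (r *\<^sub>R a - (1 / r) *\<^sub>R 1) * (r *\<^sub>R a - (1 / r) *\<^sub>R 1)
    + (2 + t / u + u / t) *\<^sub>R a" .
  have "t / u + u / t - 2 = (t - u)\<^sup>2 / (t * u)"
    using t u by (simp add: field_simps power2_eq_square)
  moreover have "0 \<le> (t - u)\<^sup>2 / (t * u)" using t u by simp
  ultimately have "4 \<le> 2 + t / u + u / t" by simp
  then have "4 *\<^sub>R a \<le> (2 + t / u + u / t) *\<^sub>R a" using a by (rule scaleR_right_mono)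
  also have "\<dots> \<le> 4 *\<^sub>R (p * q)" unfolding eq by (simp add: f_algebra_square_nonneg)
  finally show ?thesis using scaleR_left_mono[of "4 *\<^sub>R a" "4 *\<^sub>R (p * q)" "1/4"] by simp
qed

lemma Inf_sqrt_majorants:
  fixes a :: "'a::universally_complete_f_algebra"
  assumes a: "0 \<le> a"
  defines "s \<equiv> Inf (sqrt_majorants a)"
  shows "0 \<le> s" "s * s = a"
proof -
  note nonneg = sqrt_majorants_nonneg[OF a]
  show s: "0 \<le> s" unfolding s_def using sqrt_majorants_nonempty nonneg by (intro cInf_greatest)
  have "a \<le> s * s"
  proof -
    have "a \<le> p * s" if "p \<in> sqrt_majorants a" for p
      unfolding s_def using le_mult_sqrt_majorants[OF a] that nonneg sqrt_majorants_nonempty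
      by (intro le_mult_Inf) auto
    then have "a \<le> s * p" if "p \<in> sqrt_majorants a" for p
      using that by (simp add: mult.commute)
    then show ?thesis
      unfolding s_def by (intro le_mult_Inf sqrt_majorants_nonempty nonneg s[unfolded s_def]) (auto simp: s_def)
  qed
  \<comment> \<open>The discriminant criterion with \<open>X = 1\<close> and \<open>Y = a\<close>:
    its hypothesis at \<open>t\<close> says that \<open>s\<close> lies below the majorant with
    parameter \<open>1 / t\<close>.\<close>
  moreover have "s * s \<le> 1 * a"
  proof (rule f_algebra_discriminant[OF f_algebra_zero_le_one a s])
    fix t :: real
    assume "0 \<le> t"
    show "(2 * t) *\<^sub>R s \<le> (t * t) *\<^sub>R 1 + a"
    proof (cases "t = 0")
      case True
      then show ?thesis using a by simp
    next
      case False
      then have t: "t > 0" using \<open>0 \<le> t\<close> by simp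
      have "s \<le> (1/2) *\<^sub>R ((1 / t) *\<^sub>R a + (1 / (1 / t)) *\<^sub>R 1)"
        unfolding s_def using t bdd_below_sqrt_majorants[OF a]
        by (intro cInf_lower) (auto simp: sqrt_majorants_def intro!: image_eqI[of _ _ "1 / t"])
      from scaleR_left_mono[OF this, of "2 * t"] t show ?thesis
        by (simp add: scaleR_right_distrib add.commute)
    qed
  qed
  ultimately show "s * s = a" by simp
qed

lemma f_algebra_square_eq_imp_eq:
  fixes r s :: "'a::universally_complete_f_algebra"
  assumes "r * r = s * s" "0 \<le> r" "0 \<le> s"
  shows "r = s"
  using f_algebra_square_le_imp_le[of r s] f_algebra_square_le_imp_le[of s r] assms
  by (simp add: order.antisym)

section \<open>The extended conditional expectation\<close>

lemma isLub_UNIV_iff: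
  fixes D :: "'a::order set"
  shows "isLub UNIV D s \<longleftrightarrow> (\<forall>d\<in>D. d \<le> s) \<and> (\<forall>u. (\<forall>d\<in>D. d \<le> u) \<longrightarrow> s \<le> u)"
  by (auto simp: isLub_def leastP_def isUb_def setle_def setge_def)

lemma directed_up_plus:
  fixes D D' :: "'a::ordered_ab_group_add set"
  assumes "directed_up D" "directed_up D'"
  shows "directed_up {d + d' | d d'. d \<in> D \<and> d' \<in> D'}"
  unfolding directed_up_def
proof (intro conjI ballI)
  show "{d + d' | d d'. d \<in> D \<and> d' \<in> D'} \<noteq> {}"
    using assms by (auto simp: directed_up_def)
next
  fix x y
  assume "x \<in> {d + d' | d d'. d \<in> D \<and> d' \<in> D'}" "y \<in> {d + d' | d d'. d \<in> D \<and> d' \<in> D'}"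
  then obtain a a' b b' where ab: "x = a + a'" "y = b + b'" "a \<in> D" "b \<in> D" "a' \<in> D'" "b' \<in> D'"
    by blast
  obtain c where c: "c \<in> D" "a \<le> c" "b \<le> c"
    using assms(1) ab by (auto simp: directed_up_def)
  obtain c' where c': "c' \<in> D'" "a' \<le> c'" "b' \<le> c'"
    using assms(2) ab by (auto simp: directed_up_def)
  have "x \<le> c + c'" "y \<le> c + c'" using ab c c' by (auto intro: add_mono)
  then show "\<exists>z\<in>{d + d' | d d'. d \<in> D \<and> d' \<in> D'}. x \<le> z \<and> y \<le> z"
    using c c' by blast
qed

lemma directed_up_image:
  fixes D :: "'a::order set"
  assumes "directed_up D" "\<And>x y. x \<in> D \<Longrightarrow> y \<in> D \<Longrightarrow> x \<le> y \<Longrightarrow> \<phi> x \<le> (\<phi> y :: 'b::order)"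
  shows "directed_up (\<phi> ` D)"
  unfolding directed_up_def
proof (intro conjI ballI)
  show "\<phi> ` D \<noteq> {}" using assms(1) by (auto simp: directed_up_def)
next
  fix x y assume "x \<in> \<phi> ` D" "y \<in> \<phi> ` D"
  then obtain a b where ab: "x = \<phi> a" "y = \<phi> b" "a \<in> D" "b \<in> D" by blast
  then obtain c where "c \<in> D" "a \<le> c" "b \<le> c"
    using assms(1) unfolding directed_up_def by blast
  then show "\<exists>z\<in>\<phi> ` D. x \<le> z \<and> y \<le> z" using ab assms(2) by blast
qed

lemma isLub_plus:
  fixes D D' :: "'a::ordered_ab_group_add set"
  assumes "isLub UNIV D f" "isLub UNIV D' f'"
  shows "isLub UNIV {d + d' | d d'. d \<in> D \<and> d' \<in> D'} (f + f')"
  unfolding isLub_UNIV_iff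
proof (intro conjI allI impI ballI)
  fix x assume "x \<in> {d + d' | d d'. d \<in> D \<and> d' \<in> D'}"
  then show "x \<le> f + f'" using assms by (auto simp: isLub_UNIV_iff intro: add_mono)
next
  fix u assume u: "\<forall>d\<in>{d + d' | d d'. d \<in> D \<and> d' \<in> D'}. d \<le> u"
  have "d' \<le> u - f" if d': "d' \<in> D'" for d'
  proof -
    have "d \<le> u - d'" if "d \<in> D" for d
    proof -
      have "d + d' \<le> u" using u that d' by blast
      then show ?thesis by (simp add: le_diff_eq)
    qed
    then have "f \<le> u - d'" using assms(1) by (auto simp: isLub_UNIV_iff)
    then show ?thesis by (simp add: le_diff_eq add.commute)
  qed
  then have "f' \<le> u - f" using assms(2) by (auto simp: isLub_UNIV_iff)
  then show "f + f' \<le> u" by (simp add: le_diff_eq add.commute)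
qed

lemma isLub_UNIV_cSup:
  fixes D :: "'a::conditionally_complete_lattice set"
  assumes "D \<noteq> {}" "bdd_above D"
  shows "isLub UNIV D (Sup D)"
  unfolding isLub_UNIV_iff using assms by (auto intro: cSup_upper cSup_least)

lemma isLub_UNIV_unique:
  fixes x y :: "'a::order"
  shows "isLub UNIV D x \<Longrightarrow> isLub UNIV D y \<Longrightarrow> x = y"
  by (auto simp: isLub_UNIV_iff intro: order.antisym)

lemma isLub_scaleR:
  fixes D :: "'a::ordered_real_vector set"
  assumes "isLub UNIV D f" "0 < c"
  shows "isLub UNIV ((*\<^sub>R) c ` D) (c *\<^sub>R f)"
  unfolding isLub_UNIV_iff
proof (intro conjI allI impI ballI)
  fix x assume "x \<in> (*\<^sub>R) c ` D"
  then show "x \<le> c *\<^sub>R f" using assms by (auto simp: isLub_UNIV_iff intro: scaleR_left_mono)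
next
  fix u assume u: "\<forall>d\<in>(*\<^sub>R) c ` D. d \<le> u"
  have "d \<le> u /\<^sub>R c" if "d \<in> D" for d
    using u that assms(2) by (simp add: pos_le_divideR_eq)
  then have "f \<le> u /\<^sub>R c" using assms(1) by (auto simp: isLub_UNIV_iff)
  then show "c *\<^sub>R f \<le> u" using assms(2) by (simp add: pos_le_divideR_eq)
qed

text \<open>Follows from \<open>x + y = inf x y + sup x y\<close> and
  \<open>sup x y \<le> f\<close>. The lower bound is linear in \<open>y\<close>, which lets suprema
  of directed sets pass through \<open>inf x\<close>.\<close>

lemma add_diff_le_inf:
  fixes x y f :: "'a::lattice_ab_group_add"
  assumes "x \<le> f" "y \<le> f"
  shows "x + y - f \<le> inf x y"
proof -
  have "x + y \<le> f + inf x y"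
    unfolding add_eq_inf_sup[of x y] using assms by (intro add_right_mono) simp
  then show ?thesis by (simp only: diff_le_eq add.commute)
qed

section \<open>\<open>E\<close> as an ideal of its universal completion, and order continuity of
  \<open>T\<close>\<close>

context riesz_conditional_expectation
begin

lemma E_subspace: "subspace E"
  using E_riesz_subspace by (simp add: riesz_subspace_def)

lemmas E_0 = subspace_0[OF E_subspace]
  and E_add = subspace_add[OF E_subspace]
  and E_diff = subspace_diff[OF E_subspace]
  and E_scaleR = subspace_scale[OF E_subspace]

lemma E_inf: "x \<in> E \<Longrightarrow> y \<in> E \<Longrightarrow> inf x y \<in> E"
  using E_riesz_subspace by (simp add: riesz_subspace_def)

lemma one_in_E: "1 \<in> E"
  using one_weak_order_unit by (simp add: weak_order_unit_def)

lemma T_diff: "x \<in> E \<Longrightarrow> y \<in> E \<Longrightarrow> T (x - y) = T x - T y"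
  using T_add[of "x - y" y] by (simp add: E_diff)

lemma T_mono: "x \<in> E \<Longrightarrow> y \<in> E \<Longrightarrow> x \<le> y \<Longrightarrow> T x \<le> T y"
  using T_positive[of "y - x"] by (simp add: E_diff T_diff)

lemma exists_pos_below: "0 < x \<Longrightarrow> \<exists>y\<in>E. 0 < y \<and> y \<le> x"
  using E_order_dense by (simp add: order_dense_def)

text \<open>If an upper bound \<open>u\<close> were not above \<open>g\<close>, the gap
  \<open>g - inf u g\<close> would contain some positive \<open>y\<close> in \<open>E\<close>. Each
  multiple of \<open>y\<close> below \<open>g\<close> is then below \<open>inf u g\<close>, so the
  next multiple is below \<open>g\<close> as well, against the Archimedean property.\<close>

lemma E_isLub_below:
  assumes g: "0 \<le> g"
  shows "isLub UNIV {x \<in> E. 0 \<le> x \<and> x \<le> g} g"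
  unfolding isLub_UNIV_iff
proof (intro conjI allI impI)
  fix u assume u: "\<forall>d\<in>{x \<in> E. 0 \<le> x \<and> x \<le> g}. d \<le> u"
  show "g \<le> u"
  proof (rule ccontr)
    assume "\<not> g \<le> u"
    then have "inf u g \<noteq> g" by (metis inf_le1)
    then have "0 < g - inf u g" by (simp add: less_le)
    then obtain y where y: "y \<in> E" "0 < y" "y \<le> g - inf u g" using exists_pos_below by blast
    have "real n *\<^sub>R y \<le> g" for n
    proof (induction n)
      case 0
      show ?case using g by simp
    next
      case (Suc n)
      have "real n *\<^sub>R y \<in> {x \<in> E. 0 \<le> x \<and> x \<le> g}"
        using Suc y by (auto simp: E_scaleR intro: scaleR_nonneg_nonneg)
      then have "real n *\<^sub>R y \<le> inf u g" using u by auto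
      from add_mono[OF this y(3)] show ?case by (simp add: algebra_simps)
    qed
    then have "y \<le> 0" by (rule archimedean_nonpos)
    then show False using y by simp
  qed
qed auto

text \<open>The supremum taken inside \<open>E\<close> of the elements below \<open>g\<close> must
  be \<open>g\<close> itself: order density would put an element of \<open>E\<close> into any gap,
  and subtracting it would give a smaller upper bound in \<open>E\<close>.\<close>

lemma E_solid:
  assumes g: "0 \<le> g" "g \<le> d" and d: "d \<in> E"
  shows "g \<in> E"
proof -
  define B where "B = {x \<in> E. 0 \<le> x \<and> x \<le> g}"
  have lub: "isLub UNIV B g" unfolding B_def by (rule E_isLub_below[OF g(1)])
  have "isUb E B d" using g d by (auto simp: B_def isUb_def setle_def)
  moreover have "B \<subseteq> E" "B \<noteq> {}" using E_0 g by (auto simp: B_def)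
  ultimately obtain s where s: "isLub E B s"
    using E_dedekind_complete unfolding dedekind_complete_def by blast
  have sE: "s \<in> E" and sB: "\<forall>x\<in>B. x \<le> s"
    and s_le: "\<And>u. u \<in> E \<Longrightarrow> \<forall>x\<in>B. x \<le> u \<Longrightarrow> s \<le> u"
    using s by (auto simp: isLub_def leastP_def isUb_def setle_def setge_def)
  have gs: "g \<le> s" using lub sB by (simp add: isLub_UNIV_iff)
  have "g = s"
  proof (rule ccontr)
    assume "g \<noteq> s"
    then have "0 < s - g" using gs by (simp add: less_le)
    then obtain y where y: "y \<in> E" "0 < y" "y \<le> s - g" using exists_pos_below by blast
    have "g \<le> s - y" using y(3) by (simp add: le_diff_eq add.commute)
    then have "\<forall>x\<in>B. x \<le> s - y" by (auto simp: B_def intro: order_trans)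
    then have "s \<le> s - y" using s_le[of "s - y"] sE y by (simp add: E_diff)
    then show False using y by simp
  qed
  then show ?thesis using sE by simp
qed

text \<open>Order continuity of \<open>T\<close> speaks of infima inside \<open>E\<close>, while
  \<open>u\<close> ranges over the universal completion. A lower bound with nonzero positive part
  would dominate a positive element of \<open>E\<close>.\<close>

lemma T_order_continuous_UNIV:
  assumes D: "D \<subseteq> E" "directed_down D" "\<forall>d\<in>D. 0 \<le> d"
    and inf0: "\<And>u. \<forall>d\<in>D. u \<le> d \<Longrightarrow> u \<le> 0"
    and u: "\<forall>d\<in>D. u \<le> T d"
  shows "u \<le> 0"
proof (rule ccontr)
  assume "\<not> u \<le> 0"
  then have "0 < pprt u" using le_zero_iff_zero_pprt[of u] by (simp add: less_le)
  then obtain y where y: "y \<in> E" "0 < y" "y \<le> pprt u" using exists_pos_below by blast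
  have "isGlb E D 0"
    using D E_0 inf0 by (auto simp: isGlb_def greatestP_def isLb_def setle_def setge_def)
  then have "isGlb E (T ` D) 0" using D by (intro T_order_continuous)
  moreover have "y \<le> T d" if "d \<in> D" for d
    using y(3) pprt_least[of u "T d"] u that T_positive[of d] D by force
  ultimately have "y \<le> 0"
    using y by (auto simp: isGlb_def greatestP_def isLb_def setle_def setge_def)
  then show False using y by simp
qed

section \<open>The extension of \<open>T\<close> on nonnegative elements\<close>

lemma approximatesD:
  assumes "approximates E T D f"
  shows "D \<subseteq> E" "\<And>d. d \<in> D \<Longrightarrow> d \<in> E" "\<And>d. d \<in> D \<Longrightarrow> 0 \<le> d" "directed_up D" "D \<noteq> {}"
    "isLub UNIV D f" "bdd_above (T ` D)" "\<And>d. d \<in> D \<Longrightarrow> d \<le> f"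
    "isLub UNIV (T ` D) (Sup (T ` D))" "\<And>d. d \<in> D \<Longrightarrow> T d \<le> Sup (T ` D)"
proof -
  have D: "D \<subseteq> E" "\<forall>d\<in>D. 0 \<le> d" "directed_up D" "isLub UNIV D f" "bdd_above (T ` D)"
    using assms by (auto simp: approximates_def)
  have ne: "D \<noteq> {}" using D(3) by (simp add: directed_up_def)
  then have lub: "isLub UNIV (T ` D) (Sup (T ` D))" using D(5) by (intro isLub_UNIV_cSup) auto
  show "D \<subseteq> E" "\<And>d. d \<in> D \<Longrightarrow> d \<in> E" "\<And>d. d \<in> D \<Longrightarrow> 0 \<le> d" "directed_up D" "D \<noteq> {}"
    "isLub UNIV D f" "bdd_above (T ` D)" "isLub UNIV (T ` D) (Sup (T ` D))"
    using D ne lub by auto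
  show "\<And>d. d \<in> D \<Longrightarrow> d \<le> f" "\<And>d. d \<in> D \<Longrightarrow> T d \<le> Sup (T ` D)"
    using D(4) lub by (auto simp: isLub_UNIV_iff)
qed

text \<open>For fixed \<open>d\<close> in \<open>D\<close>, the elements \<open>d - inf d d'\<close>
  decrease to \<open>0\<close>, because \<open>D'\<close> increases to \<open>f'\<close>, which is
  above \<open>d\<close>. Order continuity carries this over to their images, and
  \<open>T (inf d d') \<le> T d'\<close>. The case \<open>f = f'\<close> gives independence of the
  net.\<close>

lemma Sup_approximates_mono:
  assumes D: "approximates E T D f" and D': "approximates E T D' f'" and le: "f \<le> f'"
  shows "Sup (T ` D) \<le> Sup (T ` D')"
proof (rule cSup_least)
  show "T ` D \<noteq> {}" using approximatesD(5)[OF D] by simp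
next
  note D'D = approximatesD[OF D']
  fix x assume "x \<in> T ` D"
  then obtain d where d: "d \<in> D" "x = T d" by blast
  have dE: "d \<in> E" and d0: "0 \<le> d" using approximatesD(2,3)[OF D] d by auto
  define B where "B = (\<lambda>d'. d - inf d d') ` D'"
  have mono: "d - inf d b \<le> d - inf d a" if "a \<le> b" for a b
    using that by (intro diff_left_mono inf_mono) auto
  have "T d - Sup (T ` D') \<le> 0"
  proof (rule T_order_continuous_UNIV)
    show "B \<subseteq> E" using D'D(2) dE by (auto simp: B_def intro!: E_diff E_inf)
    show "directed_down B"
      unfolding directed_down_def
    proof (intro conjI ballI)
      show "B \<noteq> {}" using D'D(5) by (simp add: B_def)
    next
      fix x y assume "x \<in> B" "y \<in> B"
      then obtain a b where ab: "a \<in> D'" "b \<in> D'" "x = d - inf d a" "y = d - inf d b"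
        unfolding B_def by blast
      then obtain c where "c \<in> D'" "a \<le> c" "b \<le> c" using D'D(4) unfolding directed_up_def by blast
      then show "\<exists>z\<in>B. z \<le> x \<and> z \<le> y" unfolding B_def using ab mono by blast
    qed
    show "\<forall>d\<in>B. 0 \<le> d" by (auto simp: B_def)
  next
    fix u assume u: "\<forall>b\<in>B. u \<le> b"
    have "d' \<le> f' - u" if d': "d' \<in> D'" for d'
    proof -
      have "d \<le> f'" using approximatesD(8)[OF D d(1)] le by simp
      then have "d + d' - f' \<le> inf d d'" using D'D(8)[OF d'] by (rule add_diff_le_inf)
      moreover have "u \<le> d - inf d d'" using u d' unfolding B_def by blast
      ultimately have "u + (d + d' - f') \<le> (d - inf d d') + inf d d'" by (intro add_mono)
      then have "u + (d + d' - f') \<le> d" by simp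
      then show ?thesis by (simp add: algebra_simps)
    qed
    then have "f' \<le> f' - u" using D'D(6) by (simp add: isLub_UNIV_iff)
    then show "u \<le> 0" by simp
  next
    show "\<forall>b\<in>B. T d - Sup (T ` D') \<le> T b"
    proof
      fix b assume "b \<in> B"
      then obtain d' where d': "d' \<in> D'" "b = d - inf d d'" unfolding B_def by blast
      have "T (inf d d') \<le> T d'" using dE D'D(2) d' by (intro T_mono E_inf) auto
      also have "\<dots> \<le> Sup (T ` D')" using d' D'D(10) by simp
      finally have "T d - Sup (T ` D') \<le> T d - T (inf d d')" by (rule diff_left_mono)
      also have "\<dots> = T b" using d' dE D'D(2) by (simp add: T_diff E_inf)
      finally show "T d - Sup (T ` D') \<le> T b" .
    qed
  qed
  then show "x \<le> Sup (T ` D')" using d by simp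
qed

lemma ext_pos_eq:
  assumes "approximates E T D f"
  shows "ext_pos E T f = Sup (T ` D)"
  unfolding ext_pos_def
proof (rule the_equality)
  show "\<exists>D'. approximates E T D' f \<and> Sup (T ` D) = Sup (T ` D')" using assms by blast
  fix s assume "\<exists>D'. approximates E T D' f \<and> s = Sup (T ` D')"
  then show "s = Sup (T ` D)"
    using assms Sup_approximates_mono by (auto intro!: order.antisym)
qed

lemma ext_pos_eqI:
  assumes "approximates E T D f" "isLub UNIV (T ` D) s"
  shows "ext_pos E T f = s"
  using ext_pos_eq[OF assms(1)] isLub_UNIV_unique[OF approximatesD(9)[OF assms(1)] assms(2)] by simp

lemma approximates_nonneg: "approximates E T D f \<Longrightarrow> 0 \<le> f"
  using approximatesD(3,5,8) by (metis all_not_in_conv order_trans)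

lemma L1_posE:
  assumes "f \<in> L1_pos E T"
  obtains D where "approximates E T D f" "isLub UNIV (T ` D) (ext_pos E T f)"
  using assms ext_pos_eq approximatesD(9) unfolding L1_pos_def by fastforce

lemma L1_posI: "approximates E T D f \<Longrightarrow> f \<in> L1_pos E T"
  using approximates_nonneg by (auto simp: L1_pos_def)

lemma L1_pos_nonneg: "f \<in> L1_pos E T \<Longrightarrow> 0 \<le> f"
  by (simp add: L1_pos_def)

lemma ext_pos_mono:
  assumes "f \<in> L1_pos E T" "g \<in> L1_pos E T" "f \<le> g"
  shows "ext_pos E T f \<le> ext_pos E T g"
  using assms Sup_approximates_mono ext_pos_eq by (elim L1_posE) metis

lemma approximates_E:
  assumes "x \<in> E" "0 \<le> x"
  shows "approximates E T {x} x"
  using assms by (auto simp: approximates_def directed_up_def isLub_UNIV_iff)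

lemma L1_pos_E: "x \<in> E \<Longrightarrow> 0 \<le> x \<Longrightarrow> x \<in> L1_pos E T"
  using approximates_E by (rule L1_posI)

lemma ext_pos_E: "x \<in> E \<Longrightarrow> 0 \<le> x \<Longrightarrow> ext_pos E T x = T x"
  using ext_pos_eq[OF approximates_E] by simp

lemma ext_pos_nonneg:
  assumes "f \<in> L1_pos E T"
  shows "0 \<le> ext_pos E T f"
  using ext_pos_mono[OF L1_pos_E[OF E_0] assms] ext_pos_E[OF E_0] L1_pos_nonneg[OF assms]
    T_diff[OF E_0 E_0] by simp

lemma L1_pos_add:
  assumes "f \<in> L1_pos E T" "g \<in> L1_pos E T"
  shows "f + g \<in> L1_pos E T" "ext_pos E T (f + g) = ext_pos E T f + ext_pos E T g"
proof -
  obtain D where D: "approximates E T D f" "isLub UNIV (T ` D) (ext_pos E T f)"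
    using assms(1) by (rule L1_posE)
  obtain D' where D': "approximates E T D' g" "isLub UNIV (T ` D') (ext_pos E T g)"
    using assms(2) by (rule L1_posE)
  define C where "C = {d + d' | d d'. d \<in> D \<and> d' \<in> D'}"
  have "T ` C = {t + t' | t t'. t \<in> T ` D \<and> t' \<in> T ` D'}"
  proof (intro set_eqI iffI)
    fix x assume "x \<in> T ` C"
    then obtain d d' where "d \<in> D" "d' \<in> D'" "x = T (d + d')" unfolding C_def by blast
    then show "x \<in> {t + t' | t t'. t \<in> T ` D \<and> t' \<in> T ` D'}"
      using T_add approximatesD(2)[OF D(1)] approximatesD(2)[OF D'(1)] by blast
  next
    fix x assume "x \<in> {t + t' | t t'. t \<in> T ` D \<and> t' \<in> T ` D'}"
    then obtain d d' where d: "d \<in> D" "d' \<in> D'" "x = T d + T d'" by blast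
    then have "x = T (d + d')"
      using T_add approximatesD(2)[OF D(1)] approximatesD(2)[OF D'(1)] by simp
    then show "x \<in> T ` C" using d unfolding C_def by blast
  qed
  then have lub: "isLub UNIV (T ` C) (ext_pos E T f + ext_pos E T g)"
    using isLub_plus[OF D(2) D'(2)] by simp
  have C: "approximates E T C (f + g)"
    unfolding approximates_def
  proof (intro conjI ballI)
    show "C \<subseteq> E"
      using approximatesD(2)[OF D(1)] approximatesD(2)[OF D'(1)] by (auto simp: C_def E_add)
    show "0 \<le> d" if "d \<in> C" for d
      using that approximatesD(3)[OF D(1)] approximatesD(3)[OF D'(1)] by (auto simp: C_def)
    show "directed_up C" unfolding C_def
      by (intro directed_up_plus approximatesD(4)[OF D(1)] approximatesD(4)[OF D'(1)])
    show "isLub UNIV C (f + g)" unfolding C_def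
      by (intro isLub_plus approximatesD(6)[OF D(1)] approximatesD(6)[OF D'(1)])
    show "bdd_above (T ` C)" using lub unfolding isLub_UNIV_iff bdd_above_def by blast
  qed
  show "f + g \<in> L1_pos E T" using C by (rule L1_posI)
  show "ext_pos E T (f + g) = ext_pos E T f + ext_pos E T g" using C lub by (rule ext_pos_eqI)
qed

lemma L1_pos_scaleR:
  assumes f: "f \<in> L1_pos E T" and c: "0 \<le> c"
  shows "c *\<^sub>R f \<in> L1_pos E T" "ext_pos E T (c *\<^sub>R f) = c *\<^sub>R ext_pos E T f"
proof -
  have "c *\<^sub>R f \<in> L1_pos E T \<and> ext_pos E T (c *\<^sub>R f) = c *\<^sub>R ext_pos E T f"
  proof (cases "c = 0")
    case True
    then show ?thesis using L1_pos_E[OF E_0] ext_pos_E[OF E_0] T_diff[OF E_0 E_0] by simp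
  next
    case False
    then have c0: "0 < c" using c by simp
    obtain D where D: "approximates E T D f" "isLub UNIV (T ` D) (ext_pos E T f)"
      using f by (rule L1_posE)
    define C where "C = (*\<^sub>R) c ` D"
    have "T ` C = (*\<^sub>R) c ` T ` D"
      unfolding C_def image_image using approximatesD(2)[OF D(1)] by (intro image_cong T_scaleR) auto
    then have lub: "isLub UNIV (T ` C) (c *\<^sub>R ext_pos E T f)"
      using isLub_scaleR[OF D(2) c0] by simp
    have C: "approximates E T C (c *\<^sub>R f)"
      unfolding approximates_def
    proof (intro conjI ballI)
      show "C \<subseteq> E" using approximatesD(2)[OF D(1)] by (auto simp: C_def E_scaleR)
      show "0 \<le> d" if "d \<in> C" for d
        using that approximatesD(3)[OF D(1)] c by (auto simp: C_def intro: scaleR_nonneg_nonneg)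
      show "directed_up C" unfolding C_def
        using c by (intro directed_up_image[OF approximatesD(4)[OF D(1)]] scaleR_left_mono)
      show "isLub UNIV C (c *\<^sub>R f)" unfolding C_def
        by (intro isLub_scaleR approximatesD(6)[OF D(1)] c0)
      show "bdd_above (T ` C)" using lub unfolding isLub_UNIV_iff bdd_above_def by blast
    qed
    show ?thesis using L1_posI[OF C] ext_pos_eqI[OF C lub] by simp
  qed
  then show "c *\<^sub>R f \<in> L1_pos E T" "ext_pos E T (c *\<^sub>R f) = c *\<^sub>R ext_pos E T f" by auto
qed

text \<open>Truncating the net of \<open>f\<close> by \<open>g\<close> gives a net for
  \<open>g\<close>; its members lie in \<open>E\<close> because \<open>E\<close> is an ideal, even
  when \<open>g\<close> does not.\<close>

lemma L1_pos_solid: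
  assumes f: "f \<in> L1_pos E T" and g: "0 \<le> g" "g \<le> f"
  shows "g \<in> L1_pos E T"
proof -
  obtain D where D: "approximates E T D f" "isLub UNIV (T ` D) (ext_pos E T f)"
    using f by (rule L1_posE)
  note DD = approximatesD[OF D(1)]
  have inE: "inf g d \<in> E" if "d \<in> D" for d
    by (rule E_solid[OF _ inf_le2 DD(2)[OF that]]) (use g DD(3)[OF that] in simp)
  have "approximates E T (inf g ` D) g"
    unfolding approximates_def
  proof (intro conjI ballI)
    show "inf g ` D \<subseteq> E" using inE by blast
    show "0 \<le> d" if "d \<in> inf g ` D" for d using that g DD(3) by auto
    show "directed_up (inf g ` D)" using inf_mono by (intro directed_up_image[OF DD(4)]) auto
    show "isLub UNIV (inf g ` D) g"
      unfolding isLub_UNIV_iff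
    proof (intro conjI allI impI)
      fix u assume u: "\<forall>d\<in>inf g ` D. d \<le> u"
      have "d \<le> u - g + f" if d: "d \<in> D" for d
      proof -
        have "g + d - f \<le> u"
          using order_trans[OF add_diff_le_inf[OF g(2) DD(8)[OF d]]] u d by blast
        then show ?thesis by (simp add: algebra_simps)
      qed
      then have "f \<le> u - g + f" using DD(6) unfolding isLub_UNIV_iff by blast
      then show "g \<le> u" by simp
    qed auto
    show "bdd_above (T ` inf g ` D)"
    proof (rule bdd_aboveI)
      fix x assume "x \<in> T ` inf g ` D"
      then obtain d where d: "d \<in> D" "x = T (inf g d)" by blast
      have "T (inf g d) \<le> T d" using inE DD(2) d by (intro T_mono) auto
      then show "x \<le> Sup (T ` D)" using d DD(10)[OF d(1)] by simp
    qed
  qed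
  then show ?thesis by (rule L1_posI)
qed

lemma ext_pos_eq_0:
  assumes "f \<in> L1_pos E T" "ext_pos E T f = 0"
  shows "f = 0"
proof -
  obtain D where D: "approximates E T D f" "isLub UNIV (T ` D) (ext_pos E T f)"
    using assms(1) by (rule L1_posE)
  note DD = approximatesD[OF D(1)]
  have "d = 0" if d: "d \<in> D" for d
  proof (rule T_strictly_positive[OF DD(2,3)[OF d]])
    have "T d \<le> 0" using D(2) assms(2) d by (auto simp: isLub_UNIV_iff)
    then show "T d = 0" using T_positive[OF DD(2,3)[OF d]] by simp
  qed
  then have "f \<le> 0" using DD(6) by (auto simp: isLub_UNIV_iff)
  then show ?thesis using L1_pos_nonneg[OF assms(1)] by simp
qed

text \<open>The images of \<open>D\<close> under \<open>T\<close> form an approximating net for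
  \<open>ext_pos E T f\<close>, and \<open>T\<close> fixes each of them.\<close>

lemma ext_pos_projection:
  assumes "f \<in> L1_pos E T"
  shows "ext_pos E T f \<in> L1_pos E T" "ext_pos E T (ext_pos E T f) = ext_pos E T f"
proof -
  obtain D where D: "approximates E T D f" "isLub UNIV (T ` D) (ext_pos E T f)"
    using assms(1) by (rule L1_posE)
  note DD = approximatesD[OF D(1)]
  have TT: "T ` T ` D = T ` D"
    unfolding image_image using DD(2) T_projection by (intro image_cong) auto
  have "approximates E T (T ` D) (ext_pos E T f)"
    unfolding approximates_def
  proof (intro conjI ballI)
    show "T ` D \<subseteq> E" using T_maps DD(2) by blast
    show "0 \<le> d" if "d \<in> T ` D" for d using that DD(2,3) T_positive by auto
    show "directed_up (T ` D)" using DD(2) T_mono by (intro directed_up_image[OF DD(4)]) auto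
    show "bdd_above (T ` T ` D)" unfolding TT by (rule DD(7))
  qed (rule D(2))
  then show "ext_pos E T f \<in> L1_pos E T" "ext_pos E T (ext_pos E T f) = ext_pos E T f"
    using L1_posI ext_pos_eqI D(2) TT by auto
qed

section \<open>The extension on differences\<close>

lemma ext_diff_eq:
  assumes "f \<in> L1_pos E T" "g \<in> L1_pos E T"
  shows "ext E T (f - g) = ext_pos E T f - ext_pos E T g"
  unfolding ext_def
proof (rule the_equality)
  fix s assume "\<exists>f'\<in>L1_pos E T. \<exists>g'\<in>L1_pos E T.
    f - g = f' - g' \<and> s = ext_pos E T f' - ext_pos E T g'"
  then obtain f' g' where fg': "f' \<in> L1_pos E T" "g' \<in> L1_pos E T"
    "f - g = f' - g'" "s = ext_pos E T f' - ext_pos E T g'" by blast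
  then have "f = f' - g' + g" by (metis diff_add_cancel)
  then have "f + g' = f' + g" by simp
  then have "ext_pos E T f + ext_pos E T g' = ext_pos E T f' + ext_pos E T g"
    using assms fg' L1_pos_add(2) by metis
  then have "ext_pos E T f - ext_pos E T g = ext_pos E T f' - ext_pos E T g'"
    by (metis add_diff_cancel_right' add_diff_eq diff_add_eq)
  then show "s = ext_pos E T f - ext_pos E T g"
    using fg'(4) by simp
qed (use assms in blast)

lemma L1E:
  assumes "h \<in> L1 E T"
  obtains f g where "f \<in> L1_pos E T" "g \<in> L1_pos E T" "h = f - g"
  using assms unfolding L1_def by blast

lemma L1_I: "f \<in> L1_pos E T \<Longrightarrow> g \<in> L1_pos E T \<Longrightarrow> f - g \<in> L1 E T"
  unfolding L1_def by blast

lemma L1_add: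
  assumes "h \<in> L1 E T" "h' \<in> L1 E T"
  shows "h + h' \<in> L1 E T" "ext E T (h + h') = ext E T h + ext E T h'"
proof -
  obtain f g where fg: "f \<in> L1_pos E T" "g \<in> L1_pos E T" "h = f - g" using assms(1) by (rule L1E)
  obtain f' g' where fg': "f' \<in> L1_pos E T" "g' \<in> L1_pos E T" "h' = f' - g'"
    using assms(2) by (rule L1E)
  have eq: "h + h' = (f + f') - (g + g')" using fg fg' by simp
  show "h + h' \<in> L1 E T" unfolding eq by (intro L1_I L1_pos_add fg fg')
  show "ext E T (h + h') = ext E T h + ext E T h'"
    unfolding eq using fg fg' by (simp add: ext_diff_eq L1_pos_add)
qed

lemma L1_uminus:
  assumes "h \<in> L1 E T"
  shows "- h \<in> L1 E T" "ext E T (- h) = - ext E T h"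
proof -
  obtain f g where fg: "f \<in> L1_pos E T" "g \<in> L1_pos E T" "h = f - g" using assms(1) by (rule L1E)
  then have eq: "- h = g - f" by simp
  show "- h \<in> L1 E T" unfolding eq by (intro L1_I fg)
  show "ext E T (- h) = - ext E T h" unfolding eq using fg by (simp add: ext_diff_eq)
qed

lemma L1_scaleR_nonneg:
  assumes "h \<in> L1 E T" "0 \<le> c"
  shows "c *\<^sub>R h \<in> L1 E T" "ext E T (c *\<^sub>R h) = c *\<^sub>R ext E T h"
proof -
  obtain f g where fg: "f \<in> L1_pos E T" "g \<in> L1_pos E T" "h = f - g" using assms(1) by (rule L1E)
  then have eq: "c *\<^sub>R h = c *\<^sub>R f - c *\<^sub>R g" by (simp add: scaleR_right_diff_distrib)
  show "c *\<^sub>R h \<in> L1 E T" unfolding eq by (intro L1_I L1_pos_scaleR fg assms)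
  show "ext E T (c *\<^sub>R h) = c *\<^sub>R ext E T h"
    unfolding eq using fg assms(2) by (simp add: ext_diff_eq L1_pos_scaleR scaleR_right_diff_distrib)
qed

lemma zero_in_L1_pos: "0 \<in> L1_pos E T"
  using L1_pos_E[OF E_0] by simp

lemma ext_pos_0: "ext_pos E T 0 = 0"
  using L1_pos_scaleR(2)[OF zero_in_L1_pos, of 0] by simp

lemma L1_pos_L1: "f \<in> L1_pos E T \<Longrightarrow> f \<in> L1 E T"
  using L1_I[OF _ zero_in_L1_pos] by fastforce

lemma ext_eq_ext_pos: "f \<in> L1_pos E T \<Longrightarrow> ext E T f = ext_pos E T f"
  using ext_diff_eq[OF _ zero_in_L1_pos] ext_pos_0 by simp

lemma L1_nonneg_L1_pos:
  assumes "h \<in> L1 E T" "0 \<le> h"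
  shows "h \<in> L1_pos E T"
proof -
  obtain f g where fg: "f \<in> L1_pos E T" "g \<in> L1_pos E T" "h = f - g" using assms(1) by (rule L1E)
  then have "h \<le> f" using L1_pos_nonneg[of g] by simp
  then show ?thesis by (rule L1_pos_solid[OF fg(1) assms(2)])
qed

lemma L1_diff:
  assumes "h \<in> L1 E T" "h' \<in> L1 E T"
  shows "h - h' \<in> L1 E T" "ext E T (h - h') = ext E T h - ext E T h'"
  using L1_add[of h "- h'"] L1_uminus[of h'] assms by auto

lemma ext_nonneg: "h \<in> L1 E T \<Longrightarrow> 0 \<le> h \<Longrightarrow> 0 \<le> ext E T h"
  using L1_nonneg_L1_pos ext_eq_ext_pos ext_pos_nonneg by simp

lemma ext_mono: "h \<in> L1 E T \<Longrightarrow> h' \<in> L1 E T \<Longrightarrow> h \<le> h' \<Longrightarrow> ext E T h \<le> ext E T h'"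
  using ext_nonneg[of "h' - h"] L1_diff[of h' h] by simp

lemma L1_squeeze:
  assumes "f \<in> L1 E T" "- f \<le> h" "h \<le> f"
  shows "h \<in> L1 E T"
proof -
  have "0 \<le> h + f" using add_right_mono[OF assms(2), of f] by simp
  moreover have "h + f \<le> f + f" using assms(3) by (rule add_right_mono)
  moreover from calculation have "0 \<le> f + f" by (rule order_trans)
  ultimately have "h + f \<in> L1_pos E T"
    using L1_pos_solid[OF L1_nonneg_L1_pos[OF L1_add(1)[OF assms(1,1)]]] by blast
  then show ?thesis using L1_diff(1)[OF L1_pos_L1 assms(1)] by fastforce
qed

lemma ext_eq_0: "h \<in> L1 E T \<Longrightarrow> 0 \<le> h \<Longrightarrow> ext E T h = 0 \<Longrightarrow> h = 0"
  using L1_nonneg_L1_pos ext_eq_ext_pos ext_pos_eq_0 by simp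

lemma one_in_L1: "1 \<in> L1 E T"
  using L1_pos_L1 L1_pos_E[OF one_in_E f_algebra_zero_le_one] by simp

lemma ext_1: "ext E T 1 = 1"
  using ext_eq_ext_pos[OF L1_pos_E] ext_pos_E one_in_E T_one f_algebra_zero_le_one by metis

lemma ext_projection:
  assumes "h \<in> L1 E T"
  shows "ext E T h \<in> L1 E T" "ext E T (ext E T h) = ext E T h"
proof -
  obtain f g where fg: "f \<in> L1_pos E T" "g \<in> L1_pos E T" "h = f - g" using assms(1) by (rule L1E)
  then show "ext E T h \<in> L1 E T" "ext E T (ext E T h) = ext E T h"
    by (simp_all add: ext_diff_eq ext_pos_projection L1_I)
qed

section \<open>Square roots in the range algebra and the vector-valued norm\<close>

text \<open>The majorants combine \<open>a\<close> and \<open>1\<close>, both fixed by the extended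
  \<open>T\<close>, so monotonicity gives \<open>ext E T s \<le> s\<close>. The nonnegative
  difference is mapped to \<open>0\<close>, and strict positivity puts \<open>s\<close> into the
  range.\<close>

lemma ext_sqrt:
  assumes h: "h \<in> L1 E T" "0 \<le> h"
  shows "\<exists>s\<in>range_alg E T. 0 \<le> s \<and> s * s = ext E T h"
proof -
  define a where "a = ext E T h"
  define s where "s = Inf (sqrt_majorants a)"
  have a: "0 \<le> a" "a \<in> L1 E T" "ext E T a = a"
    using ext_nonneg[OF h] ext_projection[OF h(1)] by (auto simp: a_def)
  have s: "0 \<le> s" "s * s = a" using Inf_sqrt_majorants[OF a(1)] by (auto simp: s_def)
  have s_le: "s \<le> p" if "p \<in> sqrt_majorants a" for p
    unfolding s_def using that bdd_below_sqrt_majorants[OF a(1)] by (rule cInf_lower)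
  have p: "p \<in> L1 E T" "ext E T p = p" if "p \<in> sqrt_majorants a" for p
    using that a(2,3) by (auto simp: sqrt_majorants_def L1_scaleR_nonneg L1_add one_in_L1 ext_1)
  obtain p where p0: "p \<in> sqrt_majorants a" using sqrt_majorants_nonempty by blast
  have sL1: "s \<in> L1 E T"
    using L1_pos_L1[OF L1_pos_solid[OF L1_nonneg_L1_pos s(1) s_le[OF p0]]] p(1)[OF p0]
      order_trans[OF s(1) s_le[OF p0]] by blast
  have "ext E T s \<le> s"
    unfolding s_def
  proof (rule cInf_greatest[OF sqrt_majorants_nonempty])
    fix q assume q: "q \<in> sqrt_majorants a"
    show "ext E T (Inf (sqrt_majorants a)) \<le> q"
      using ext_mono[OF sL1 p(1)[OF q] s_le[OF q]] p(2)[OF q] by (simp add: s_def)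
  qed
  then have "0 \<le> s - ext E T s" by simp
  moreover have "ext E T (s - ext E T s) = 0"
    using L1_diff(2)[OF sL1 ext_projection(1)[OF sL1]] ext_projection(2)[OF sL1] by simp
  ultimately have "s - ext E T s = 0"
    by (rule ext_eq_0[OF L1_diff(1)[OF sL1 ext_projection(1)[OF sL1]]])
  then have "s \<in> range_alg E T" using sL1 unfolding range_alg_def by (metis eq_iff_diff_eq_0 image_eqI)
  then show ?thesis using s a_def by auto
qed

lemma norm_T_props:
  assumes "x \<in> L2 E T"
  shows "norm_T E T x \<in> range_alg E T" "0 \<le> norm_T E T x"
    "norm_T E T x * norm_T E T x = ext E T (x * x)"
proof -
  have x: "x * x \<in> L1 E T" using assms by (simp add: L2_def power2_eq_square)
  have "\<exists>!r. r \<in> range_alg E T \<and> 0 \<le> r \<and> r\<^sup>2 = ext E T (x\<^sup>2)"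
    unfolding power2_eq_square
    using ext_sqrt[OF x f_algebra_square_nonneg] f_algebra_square_eq_imp_eq by metis
  from theI'[OF this] show "norm_T E T x \<in> range_alg E T" "0 \<le> norm_T E T x"
    "norm_T E T x * norm_T E T x = ext E T (x * x)"
    unfolding norm_T_def power2_eq_square by auto
qed

lemma norm_T_le_mult_iff:
  assumes "x \<in> L2 E T" "y \<in> L2 E T" "0 \<le> k"
  shows "norm_T E T x \<le> k * norm_T E T y \<longleftrightarrow> ext E T (x * x) \<le> k * k * ext E T (y * y)"
proof -
  define r where "r = norm_T E T x"
  define s where "s = k * norm_T E T y"
  note x = norm_T_props[OF assms(1)] and y = norm_T_props[OF assms(2)]
  have rs: "0 \<le> r" "0 \<le> s" "r * r = ext E T (x * x)"
    unfolding r_def s_def using x(2,3) mult_nonneg_nonneg[OF assms(3) y(2)] by auto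
  have "s * s = k * k * (norm_T E T y * norm_T E T y)" by (simp only: s_def mult_ac)
  then have ss: "s * s = k * k * ext E T (y * y)" by (simp only: y(3))
  have "r \<le> s \<longleftrightarrow> r * r \<le> s * s"
    using f_algebra_square_le_imp_le[of r s] mult_mono'[of r s r s] rs(1,2) by metis
  then show ?thesis unfolding rs(3) ss unfolding r_def s_def .
qed

section \<open>Cauchy--Schwarz and the bounds of an adjoint\<close>

text \<open>The squares of \<open>x + y\<close> and \<open>x - y\<close> confine
  \<open>2 *\<^sub>R (x * y)\<close> between plus and minus \<open>x * x + y * y\<close>.\<close>

lemma L2_mult:
  assumes "x \<in> L2 E T" "y \<in> L2 E T"
  shows "x * x \<in> L1 E T" "y * y \<in> L1 E T" "x * y \<in> L1 E T"
proof -
  show xx: "x * x \<in> L1 E T" "y * y \<in> L1 E T" using assms by (simp_all add: L2_def power2_eq_square)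
  have "0 \<le> (x + y) * (x + y)" "0 \<le> (x - y) * (x - y)" by (rule f_algebra_square_nonneg)+
  moreover have "(x + y) * (x + y) = x * x + y * y + 2 *\<^sub>R (x * y)"
    "(x - y) * (x - y) = x * x + y * y - 2 *\<^sub>R (x * y)"
    by (simp_all add: algebra_simps scaleR_2)
  ultimately have le: "0 \<le> x * x + y * y + 2 *\<^sub>R (x * y)" "0 \<le> x * x + y * y - 2 *\<^sub>R (x * y)"
    by metis+
  have "- (x * x + y * y) \<le> 2 *\<^sub>R (x * y)"
    using add_left_mono[OF le(1), of "- (x * x + y * y)"] by simp
  moreover have "2 *\<^sub>R (x * y) \<le> x * x + y * y"
    using le(2) by (simp only: diff_ge_0_iff_ge)
  ultimately have "2 *\<^sub>R (x * y) \<in> L1 E T" by (rule L1_squeeze[OF L1_add(1)[OF xx]])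
  from L1_scaleR_nonneg(1)[OF this, of "1/2"] show "x * y \<in> L1 E T" by simp
qed

text \<open>The sign condition supplies the nonnegative \<open>z\<close> of the discriminant
  criterion. In the application the inner product equals \<open>P\<close>, the image of a
  square.\<close>

lemma Cauchy_Schwarz_T:
  assumes x: "x \<in> L2 E T" and y: "y \<in> L2 E T" and nonneg: "0 \<le> ext E T (x * y)"
  shows "ext E T (x * y) * ext E T (x * y) \<le> ext E T (x * x) * ext E T (y * y)"
proof (rule f_algebra_discriminant)
  note L1 = L2_mult[OF x y]
  show "0 \<le> ext E T (x * x)" "0 \<le> ext E T (y * y)"
    by (rule ext_nonneg[OF L1(1) f_algebra_square_nonneg] ext_nonneg[OF L1(2) f_algebra_square_nonneg])+
  fix t :: real
  assume t: "0 \<le> t"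
  have "0 \<le> (t *\<^sub>R x - y) * (t *\<^sub>R x - y)" by (rule f_algebra_square_nonneg)
  also have "\<dots> = ((t * t) *\<^sub>R (x * x) + y * y) - (2 * t) *\<^sub>R (x * y)"
    by (simp add: algebra_simps flip: scaleR_2)
  finally have "(2 * t) *\<^sub>R (x * y) \<le> (t * t) *\<^sub>R (x * x) + y * y" by simp
  then have "ext E T ((2 * t) *\<^sub>R (x * y)) \<le> ext E T ((t * t) *\<^sub>R (x * x) + y * y)"
    using t L1 by (intro ext_mono L1_add L1_scaleR_nonneg) auto
  then show "(2 * t) *\<^sub>R ext E T (x * y) \<le> (t * t) *\<^sub>R ext E T (x * x) + ext E T (y * y)"
    using t L1 by (simp add: L1_add L1_scaleR_nonneg)
qed (rule nonneg)

lemma op_bounds_adjoint: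
  assumes S: "\<And>x. x \<in> L2 E T \<Longrightarrow> S x \<in> L2 E T"
    and R: "\<And>x. x \<in> L2 E T \<Longrightarrow> R x \<in> L2 E T"
    and adj: "\<And>x y. x \<in> L2 E T \<Longrightarrow> y \<in> L2 E T \<Longrightarrow> ext E T (S x * y) = ext E T (x * R y)"
  shows "op_bounds E T S \<subseteq> op_bounds E T R"
proof
  fix k assume k: "k \<in> op_bounds E T S"
  then have k0: "0 \<le> k" by (simp add: op_bounds_def)
  have "norm_T E T (R y) \<le> k * norm_T E T y" if y: "y \<in> L2 E T" for y
  proof -
    define P where "P = ext E T (R y * R y)"
    define Q where "Q = ext E T (y * y)"
    note Ry = R[OF y] and SRy = S[OF R[OF y]]
    have PQ: "0 \<le> P" "0 \<le> Q"
      unfolding P_def Q_def using L2_mult[OF Ry y] by (simp_all add: ext_nonneg f_algebra_square_nonneg)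
    have P: "P = ext E T (S (R y) * y)" using adj[OF Ry y] by (simp add: P_def)
    have "norm_T E T (S (R y)) \<le> k * norm_T E T (R y)" using k Ry by (simp add: op_bounds_def)
    then have SR: "ext E T (S (R y) * S (R y)) \<le> k * k * P"
      using norm_T_le_mult_iff[OF SRy Ry k0] by (simp add: P_def)
    have "P * P \<le> ext E T (S (R y) * S (R y)) * Q"
      using Cauchy_Schwarz_T[OF SRy y] PQ(1) unfolding P Q_def by simp
    also have "\<dots> \<le> k * k * P * Q" using SR PQ(2) by (rule mult_right_mono)
    finally have "(P - k * k * Q) * P \<le> 0" by (simp add: algebra_simps)
    moreover have "0 \<le> k * k * Q" using k0 PQ by (intro mult_nonneg_nonneg)
    \<comment> \<open>This replaces division by \<open>P\<close>: the difference lies below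
      \<open>P\<close>, so \<open>P\<close> is positive wherever the difference is.\<close>
    ultimately have "P - k * k * Q \<le> 0"
      using PQ by (intro f_algebra_nonpos_of_mult_nonpos[of "P - k * k * Q" P]) auto
    then show ?thesis
      using norm_T_le_mult_iff[OF Ry y k0] by (simp add: P_def Q_def)
  qed
  then show "k \<in> op_bounds E T R" using k by (simp add: op_bounds_def)
qed

end

theorem theorem8p4:
  fixes E :: "'a::universally_complete_f_algebra set"
    and T S S_adj :: "'a \<Rightarrow> 'a"
  assumes "riesz_conditional_expectation E T"
    and "S \<in> bounded_ops E T"
    and "is_adjoint E T S S_adj"
  shows "op_norm_T E T S_adj = op_norm_T E T S"
proof -
  interpret riesz_conditional_expectation E T by fact
  have maps: "S x \<in> L2 E T" "S_adj x \<in> L2 E T" if "x \<in> L2 E T" for x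
    using assms(2,3) that by (auto simp: bounded_ops_def is_adjoint_def)
  have adj: "ext E T (S x * y) = ext E T (x * S_adj y)" if "x \<in> L2 E T" "y \<in> L2 E T" for x y
    using assms(3) that by (simp add: is_adjoint_def inner_T_def)
  \<comment> \<open>By commutativity \<open>S\<close> is in turn adjoint to \<open>S_adj\<close>,
    which yields the reverse inclusion of the sets of bounds.\<close>
  have adj': "ext E T (S_adj x * y) = ext E T (x * S y)" if "x \<in> L2 E T" "y \<in> L2 E T" for x y
    using adj[OF that(2,1)] by (simp add: mult.commute)
  have "op_bounds E T S_adj = op_bounds E T S"
    using op_bounds_adjoint[OF maps adj] op_bounds_adjoint[OF maps(2,1) adj'] by blast
  then show ?thesis by (simp only: op_norm_T_def)
qed

end
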